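(* Let $A$ be a set in $\mathbb{Z}^d$ with $|A|\le 5$, and let $\Omega:=A+[0,1)^d\subset\mathbb{R}^d$ be the corresponding union of unit cubes. If $\Omega$ is spectral in $\mathbb{R}^d$, then $\Omega$ tiles $\mathbb{R}^d$ by translation.
   Context: A bounded measurable set $\Omega\subset\mathbb{R}^d$ is spectral if there exists a set $\Lambda\subset\mathbb{R}^d$ such that the exponentials $x\mapsto e^{2\pi i\lambda\cdot x}$, $\lambda\in\Lambda$, form an orthogonal basis of $L^2(\Omega)$ (Lebesgue measure). $\Omega$ tiles $\mathbb{R}^d$ by translation if there exists $T\subseteq\mathbb{R}^d$ such that $\sum_{t\in T}\chi_\Omega(x-t)=1$ for almost every $x\in\mathbb{R}^d$. *)

theory Defs
  imports "HOL-Analysis.Analysis"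
begin

definition expo :: "real^'n \<Rightarrow> real^'n \<Rightarrow> complex" where
  "expo l x = exp (complex_of_real (2 * pi * (l \<bullet> x)) * \<i>)"

definition L2_on :: "(real^'n) set \<Rightarrow> (real^'n \<Rightarrow> complex) \<Rightarrow> bool" where
  "L2_on \<Omega> f \<longleftrightarrow> f \<in> borel_measurable lebesgue \<and>
      set_integrable lebesgue \<Omega> (\<lambda>x. (norm (f x))\<^sup>2)"

text \<open>The exponentials indexed by Lambda form an orthogonal basis of L^2(Omega):
  they are pairwise orthogonal in L^2(Omega), and complete (only the zero element
  of L^2(Omega) is orthogonal to all of them).\<close>
definition spectrum_of :: "(real^'n) set \<Rightarrow> (real^'n) set \<Rightarrow> bool" where
  "spectrum_of \<Omega> \<Lambda> \<longleftrightarrow>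
     (\<forall>l\<in>\<Lambda>. \<forall>m\<in>\<Lambda>. l \<noteq> m \<longrightarrow>
        (LINT x:\<Omega>|lebesgue. expo l x * cnj (expo m x)) = 0) \<and>
     (\<forall>f. L2_on \<Omega> f \<longrightarrow>
        (\<forall>l\<in>\<Lambda>. (LINT x:\<Omega>|lebesgue. f x * cnj (expo l x)) = 0) \<longrightarrow>
        (AE x in lebesgue. x \<in> \<Omega> \<longrightarrow> f x = 0))"

definition spectral :: "(real^'n) set \<Rightarrow> bool" where
  "spectral \<Omega> \<longleftrightarrow> (\<exists>\<Lambda>. spectrum_of \<Omega> \<Lambda>)"

text \<open>Translational tiling: sum_{t in T} chi_Omega(x - t) = 1 for a.e. x.
  (For 0/1-valued terms the unconditional sum equals 1 iff exactly one term is 1.)\<close>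
definition tiles :: "(real^'n) set \<Rightarrow> bool" where
  "tiles \<Omega> \<longleftrightarrow> (\<exists>T. AE x in lebesgue. (\<Sum>\<^sub>\<infinity>t\<in>T. indicator \<Omega> (x - t) :: real) = 1)"

definition cube_union :: "(int^'n) set \<Rightarrow> (real^'n) set" where
  "cube_union A = {x. \<exists>a\<in>A. \<forall>i. of_int (a $ i) \<le> x $ i \<and> x $ i < of_int (a $ i) + 1}"

end

theory Submission
  imports Defs
begin

text \<open>Write e(t) for exp(2 pi i t), let Q be the unit cube and N = card A. By Parseval for the function
  e(xi . x) restricted to one cell, the spectrum Lambda satisfies
  sum over l in Lambda of |Qhat(l - xi)|^2 = N for all xi. Averaging over xi in a large box of integer
  points shows that some cell k + [0,1)^d contains at least N points of Lambda. Differences of such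
  points have coordinates in (-1,1), so Qhat does not vanish there and orthogonality in L^2 means that the
  matrix e(l . a) is a complex Hadamard matrix of order N.

  In order 2, 3 and 5, the quotient of two rows of the matrix consists, up to a common factor, of all
  N-th roots of unity, so that A tiles the integer lattice, with translations the points x for which
  the integer part of N (u . x) is divisible by N. In order 4 two rows with suitable sign patterns suffice. For order 5
  this is Haagerup's theorem, and it follows from a count: if 1, x, y are three rows, then
  for any three columns i, j, k two of x_i y_j, x_j y_k, x_k y_i coincide; as there are 20
  oriented triangles and 20 directed edges on 5 points, this forces every product x_i y_j to occur in each
  set x_t {y_s}, so these sets coincide and (x_t / x_u)^5 = 1.\<close>

section \<open>Complex Hadamard matrices\<close>

text \<open>Testing Parseval on one cell rather than on all of Omega makes the coefficients those of
  a cube: their squares factor over the coordinates and do not depend on A, so the density estimate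
  reduces to one real variable. The boxes have side r^2 because the 1/t^2 decay then limits the
  overhead at the boundary to a multiple of r. The N points retained from Lambda need not be
  rational, so u . x takes arbitrary real values on the lattice. In orders 2, 3 and 5 integer parts
  still define a tiling, since the values N (u . a) for a in A agree up to integers. Order 4 is
  special because a free phase survives there: a quotient of rows need not consist of fourth roots
  of unity, and two functionals are used, one splitting A into two pairs and one splitting each
  pair. In order 5 the coincidences among x_i y_j, x_j y_k, x_k y_i come from a 3 by 3 permanent.
  Since 5 = 3 + 2, vanishing row sums express it through the two remaining columns, where it is seen
  to be real.\<close>

definition complex_hadamard :: "'r set \<Rightarrow> 'c set \<Rightarrow> ('r \<Rightarrow> 'c \<Rightarrow> complex) \<Rightarrow> bool" where
  "complex_hadamard R C W \<longleftrightarrow> finite R \<and> finite C \<and> card R = card C \<and>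
     (\<forall>p\<in>R. \<forall>i\<in>C. norm (W p i) = 1) \<and>
     (\<forall>p\<in>R. \<forall>q\<in>R. p \<noteq> q \<longrightarrow> (\<Sum>i\<in>C. W p i * cnj (W q i)) = 0)"

lemma unit_mult_cnj: "norm (z::complex) = 1 \<Longrightarrow> z * cnj z = 1"
  by (simp add: complex_norm_square[symmetric])

text \<open>Orthogonality of the columns follows without any linear algebra: the row and column Gram matrices
  have the same Frobenius norm, and their diagonals agree.\<close>
lemma gram_frobenius_swap:
  fixes W :: "'r \<Rightarrow> 'c \<Rightarrow> complex"
  shows "(\<Sum>i\<in>C. \<Sum>j\<in>C. (norm (\<Sum>p\<in>R. W p i * cnj (W p j)))\<^sup>2) =
    (\<Sum>p\<in>R. \<Sum>q\<in>R. (norm (\<Sum>i\<in>C. W p i * cnj (W q i)))\<^sup>2)"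
proof -
  have "complex_of_real (\<Sum>i\<in>C. \<Sum>j\<in>C. (norm (\<Sum>p\<in>R. W p i * cnj (W p j)))\<^sup>2)
     = (\<Sum>i\<in>C. \<Sum>j\<in>C. \<Sum>p\<in>R. \<Sum>q\<in>R. W p i * cnj (W p j) * (cnj (W q i) * W q j))"
    by (simp add: complex_norm_square sum_product del: of_real_power)
  also have "\<dots> = (\<Sum>i\<in>C. \<Sum>p\<in>R. \<Sum>j\<in>C. \<Sum>q\<in>R. W p i * cnj (W p j) * (cnj (W q i) * W q j))"
    by (intro sum.cong refl sum.swap)
  also have "\<dots> = (\<Sum>p\<in>R. \<Sum>i\<in>C. \<Sum>j\<in>C. \<Sum>q\<in>R. W p i * cnj (W p j) * (cnj (W q i) * W q j))"
    by (rule sum.swap)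
  also have "\<dots> = (\<Sum>p\<in>R. \<Sum>i\<in>C. \<Sum>q\<in>R. \<Sum>j\<in>C. W p i * cnj (W p j) * (cnj (W q i) * W q j))"
    by (intro sum.cong refl sum.swap)
  also have "\<dots> = (\<Sum>p\<in>R. \<Sum>q\<in>R. \<Sum>i\<in>C. \<Sum>j\<in>C. W p i * cnj (W p j) * (cnj (W q i) * W q j))"
    by (intro sum.cong refl sum.swap)
  also have "\<dots> = (\<Sum>p\<in>R. \<Sum>q\<in>R. \<Sum>i\<in>C. \<Sum>j\<in>C. (W p i * cnj (W q i)) * (cnj (W p j) * W q j))"
    by (intro sum.cong refl) (simp add: mult_ac)
  also have "\<dots> = complex_of_real (\<Sum>p\<in>R. \<Sum>q\<in>R. (norm (\<Sum>i\<in>C. W p i * cnj (W q i)))\<^sup>2)"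
    by (simp add: complex_norm_square sum_product del: of_real_power)
  finally show ?thesis by (simp only: of_real_eq_iff)
qed

lemma complex_hadamard_transpose:
  assumes "complex_hadamard R C W"
  shows "complex_hadamard C R (\<lambda>i p. W p i)"
proof -
  have fin: "finite R" "finite C" and cd: "card R = card C"
    and n1: "\<And>p i. p \<in> R \<Longrightarrow> i \<in> C \<Longrightarrow> norm (W p i) = 1"
    and orth: "\<And>p q. p \<in> R \<Longrightarrow> q \<in> R \<Longrightarrow> p \<noteq> q \<Longrightarrow> (\<Sum>i\<in>C. W p i * cnj (W q i)) = 0"
    using assms by (auto simp: complex_hadamard_def)
  let ?N = "real (card C)"
  let ?G = "\<lambda>i j. (norm (\<Sum>p\<in>R. W p i * cnj (W p j)))\<^sup>2"
  have diagR: "(norm (\<Sum>i\<in>C. W p i * cnj (W q i)))\<^sup>2 = (if q = p then ?N\<^sup>2 else 0)"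
    if "p \<in> R" "q \<in> R" for p q
    using that by (auto simp: orth n1 unit_mult_cnj)
  have diagC: "?G i i = ?N\<^sup>2" if "i \<in> C" for i
    using that by (simp add: n1 unit_mult_cnj cd)
  have "(\<Sum>i\<in>C. \<Sum>j\<in>C. ?G i j) = (\<Sum>p\<in>R. \<Sum>q\<in>R. if q = p then ?N\<^sup>2 else 0)"
    by (rule trans[OF gram_frobenius_swap]) (intro sum.cong refl diagR)
  also have "\<dots> = ?N * ?N\<^sup>2" by (simp add: fin cd)
  finally have tot: "(\<Sum>i\<in>C. \<Sum>j\<in>C. ?G i j) = ?N * ?N\<^sup>2" .
  have "(\<Sum>i\<in>C. \<Sum>j\<in>C. ?G i j) = (\<Sum>i\<in>C. ?G i i + (\<Sum>j\<in>C - {i}. ?G i j))"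
    by (intro sum.cong refl sum.remove fin)
  also have "\<dots> = ?N * ?N\<^sup>2 + (\<Sum>i\<in>C. \<Sum>j\<in>C - {i}. ?G i j)"
    by (simp add: sum.distrib diagC)
  finally have "(\<Sum>i\<in>C. \<Sum>j\<in>C - {i}. ?G i j) = 0" using tot by simp
  then have "\<forall>i\<in>C. (\<Sum>j\<in>C - {i}. ?G i j) = 0"
    by (subst (asm) sum_nonneg_eq_0_iff) (auto simp: fin intro!: sum_nonneg)
  then have "\<forall>i\<in>C. \<forall>j\<in>C - {i}. ?G i j = 0"
    using sum_nonneg_eq_0_iff[of "C - {_}" "?G _"] fin by simp
  then show ?thesis using fin cd n1 by (auto simp: complex_hadamard_def)
qed

section \<open>Permanents of three unimodular rows\<close>

lemma unit_triple_cnj: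
  fixes a b c :: complex
  assumes "norm a = 1" "norm b = 1" and abc: "a * b * c = 1"
  shows "norm c = 1" "a * b = cnj c" "b * c = cnj a" "a * c = cnj b"
proof -
  have "norm c = norm (a * b * c)" unfolding norm_mult using assms(1,2) by simp
  then show "norm c = 1" using abc by simp
  then have u: "cnj a * a = 1" "cnj b * b = 1" "c * cnj c = 1"
    using assms unit_mult_cnj by (simp_all add: mult.commute)
  have "a * b = (a * b * c) * cnj c" using u(3) by (simp add: mult.assoc)
  then show "a * b = cnj c" using abc by simp
  have "b * c = (cnj a * a) * (b * c)" using u(1) by simp
  also have "\<dots> = cnj a * (a * b * c)" by (simp add: mult_ac)
  finally show "b * c = cnj a" using abc by simp
  have "a * c = (cnj b * b) * (a * c)" using u(2) by simp
  also have "\<dots> = cnj b * (a * b * c)" by (simp add: mult_ac)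
  finally show "a * c = cnj b" using abc by simp
qed

text \<open>Of the eight terms, the two with equal indices are 1, and in each mixed one two indices
  agree, as in a1 * b1 * c2 = cnj c1 * c2. The mixed ones are the off-diagonal terms of the three
  squared norms, whose diagonals add up to 6; the constant is 2 - 6.\<close>

lemma two_column_product:
  fixes a1 a2 b1 b2 c1 c2 :: complex
  assumes n: "norm a1 = 1" "norm a2 = 1" "norm b1 = 1" "norm b2 = 1"
    and abc: "a1 * b1 * c1 = 1" "a2 * b2 * c2 = 1"
  shows "(a1 + a2) * (b1 + b2) * (c1 + c2) =
    of_real ((norm (a1 + a2))\<^sup>2 + (norm (b1 + b2))\<^sup>2 + (norm (c1 + c2))\<^sup>2 - 4)"
proof -
  note t1 = unit_triple_cnj[OF n(1,3) abc(1)] and t2 = unit_triple_cnj[OF n(2,4) abc(2)]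
  have u: "a1 * cnj a1 = 1" "a2 * cnj a2 = 1" "b1 * cnj b1 = 1" "b2 * cnj b2 = 1"
    "c1 * cnj c1 = 1" "c2 * cnj c2 = 1"
    using n t1(1) t2(1) by (simp_all add: unit_mult_cnj)
  have "(a1 + a2) * (b1 + b2) * (c1 + c2) = a1 * b1 * c1 + a2 * b2 * c2
      + ((a1 * b1) * c2 + (a2 * b2) * c1) + ((b1 * c1) * a2 + (b2 * c2) * a1) + ((a1 * c1) * b2 + (a2 * c2) * b1)"
    by (simp add: algebra_simps)
  also have "\<dots> = (a1 + a2) * (cnj a1 + cnj a2) + (b1 + b2) * (cnj b1 + cnj b2) + (c1 + c2) * (cnj c1 + cnj c2) - 4"
    unfolding abc t1(2-) t2(2-) using u by (simp add: distrib_left distrib_right mult.commute)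
  finally show ?thesis by (simp add: complex_norm_square del: of_real_power)
qed

text \<open>The permanent of the 3 by 3 matrix with rows a, b, c and columns i, j, k; the three even
  permutations are listed first.\<close>

definition perm_sum :: "('i \<Rightarrow> complex) \<Rightarrow> ('i \<Rightarrow> complex) \<Rightarrow> ('i \<Rightarrow> complex) \<Rightarrow> 'i \<Rightarrow> 'i \<Rightarrow> 'i \<Rightarrow> complex" where
  "perm_sum a b c i j k =
     a i * b j * c k + a j * b k * c i + a k * b i * c j +
     a i * b k * c j + a k * b j * c i + a j * b i * c k"

text \<open>The 27 terms are 3 with equal indices, each equal to 1, then 18 with exactly two equal
  indices, which are the off-diagonal terms of the squared norms, and 6 with distinct indices, the
  permanent. The constant is 3 - 9.\<close>

lemma three_column_product:
  fixes a b c :: "'i \<Rightarrow> complex"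
  assumes "\<And>t. t \<in> {i,j,k} \<Longrightarrow> norm (a t) = 1" "\<And>t. t \<in> {i,j,k} \<Longrightarrow> norm (b t) = 1"
    and "\<And>t. t \<in> {i,j,k} \<Longrightarrow> a t * b t * c t = 1"
  shows "(a i + a j + a k) * (b i + b j + b k) * (c i + c j + c k) =
    of_real ((norm (a i + a j + a k))\<^sup>2 + (norm (b i + b j + b k))\<^sup>2 + (norm (c i + c j + c k))\<^sup>2 - 6)
    + perm_sum a b c i j k"
proof -
  have nc: "norm (c t) = 1" and ab: "a t * b t = cnj (c t)" and bc: "b t * c t = cnj (a t)"
    and ac: "a t * c t = cnj (b t)" if "t \<in> {i,j,k}" for t
    using unit_triple_cnj[OF assms(1)[OF that] assms(2)[OF that] assms(3)[OF that]] by simp_all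
  have u: "cnj (a t) * a t = 1" "cnj (b t) * b t = 1" "cnj (c t) * c t = 1" if "t \<in> {i,j,k}" for t
    using unit_mult_cnj nc assms(1,2) that by (auto simp: mult.commute)
  have "(a i + a j + a k) * (b i + b j + b k) * (c i + c j + c k) =
     (a i * b i) * (c j + c k) + (a j * b j) * (c i + c k) + (a k * b k) * (c i + c j)
   + (b i * c i) * (a j + a k) + (b j * c j) * (a i + a k) + (b k * c k) * (a i + a j)
   + (a i * c i) * (b j + b k) + (a j * c j) * (b i + b k) + (a k * c k) * (b i + b j)
   + (a i * b i * c i + a j * b j * c j + a k * b k * c k) + perm_sum a b c i j k"
    unfolding perm_sum_def by (simp add: algebra_simps)
  also have "\<dots> =
     (cnj (c i) + cnj (c j) + cnj (c k)) * (c i + c j + c k)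
   + (cnj (a i) + cnj (a j) + cnj (a k)) * (a i + a j + a k)
   + (cnj (b i) + cnj (b j) + cnj (b k)) * (b i + b j + b k) - 6 + perm_sum a b c i j k"
    using u by (simp add: ab bc ac algebra_simps)
  finally show ?thesis by (simp add: complex_norm_square mult.commute add_ac del: of_real_power)
qed

text \<open>The vanishing sums turn each three-column sum into the negative of the complementary
  two-column sum. The two product formulas then contain the same sum S of squared norms, and
  comparing them leaves -(S - 4) - (S - 6) for the permanent.\<close>

lemma perm_sum_eq:
  fixes a b c :: "'i \<Rightarrow> complex"
  assumes na: "\<And>t. t \<in> {i,j,k,l,m} \<Longrightarrow> norm (a t) = 1" and nb: "\<And>t. t \<in> {i,j,k,l,m} \<Longrightarrow> norm (b t) = 1"
    and abc: "\<And>t. t \<in> {i,j,k,l,m} \<Longrightarrow> a t * b t * c t = 1"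
    and sa: "a i + a j + a k + a l + a m = 0" and sb: "b i + b j + b k + b l + b m = 0"
    and sc: "c i + c j + c k + c l + c m = 0"
  shows "perm_sum a b c i j k =
    of_real (10 - 2 * ((norm (a l + a m))\<^sup>2 + (norm (b l + b m))\<^sup>2 + (norm (c l + c m))\<^sup>2))"
proof -
  have e: "a i + a j + a k = - (a l + a m)" "b i + b j + b k = - (b l + b m)"
    "c i + c j + c k = - (c l + c m)"
    using sa sb sc by (simp_all only: eq_neg_iff_add_eq_0 add.assoc)
  have "- (a l + a m) * - (b l + b m) * - (c l + c m) =
    of_real ((norm (a l + a m))\<^sup>2 + (norm (b l + b m))\<^sup>2 + (norm (c l + c m))\<^sup>2 - 6)
    + perm_sum a b c i j k"
    using three_column_product[of i j k a b c] assms unfolding e norm_minus_cancel by auto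
  moreover have "(a l + a m) * (b l + b m) * (c l + c m) =
    of_real ((norm (a l + a m))\<^sup>2 + (norm (b l + b m))\<^sup>2 + (norm (c l + c m))\<^sup>2 - 4)"
    by (rule two_column_product) (auto simp: assms)
  moreover have "P = - s4 - s6" if "- A * - B * - D = s6 + P" "A * B * D = s4" for A B D s4 s6 P :: complex
    using that by algebra
  ultimately have "perm_sum a b c i j k = - of_real ((norm (a l + a m))\<^sup>2 + (norm (b l + b m))\<^sup>2 + (norm (c l + c m))\<^sup>2 - 4)
     - of_real ((norm (a l + a m))\<^sup>2 + (norm (b l + b m))\<^sup>2 + (norm (c l + c m))\<^sup>2 - 6)"
    by blast
  then show ?thesis by simp
qed

text \<open>As u * v * w = 1, the product of any two is the conjugate of the third, so (u - 1)(v -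
  1)(w - 1) is the sum minus its conjugate and vanishes for a real sum. Once one summand is 1, the
  other two contribute at least -2.\<close>

lemma unit_product_real_sum:
  fixes u v w :: complex
  assumes "norm u = 1" "norm v = 1" "norm w = 1" and uvw: "u * v * w = 1"
    and re: "Im (u + v + w) = 0"
  shows "u = 1 \<or> v = 1 \<or> w = 1" and "Re (u + v + w) \<ge> -1"
proof -
  have c: "u * cnj u = 1" "v * cnj v = 1" "w * cnj w = 1" using assms by (auto intro: unit_mult_cnj)
  have "cnj (u + v + w) = u + v + w" using re by (auto simp: complex_eq_iff)
  then have r: "cnj u + cnj v + cnj w = u + v + w" by simp
  have "(u - 1) * (v - 1) * (w - 1) = 0" using c uvw r by algebra
  then show d: "u = 1 \<or> v = 1 \<or> w = 1" by simp
  have g: "Re (x + y) \<ge> - 2" if "norm x = 1" "norm y = 1" for x y :: complex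
    using abs_Re_le_cmod[of x] abs_Re_le_cmod[of y] that by simp
  show "Re (u + v + w) \<ge> -1" using d
  proof (elim disjE)
    assume "u = 1" then show ?thesis using g[of v w] assms by simp
  next
    assume "v = 1" then show ?thesis using g[of u w] assms by simp
  next
    assume "w = 1" then show ?thesis using g[of u v] assms by simp
  qed
qed

lemma norm_pair_sums:
  fixes u v w :: complex
  assumes "norm u = 1" "norm v = 1" "norm w = 1"
  shows "(norm (u + v))\<^sup>2 + (norm (v + w))\<^sup>2 + (norm (w + u))\<^sup>2 = 3 + (norm (u + v + w))\<^sup>2"
proof -
  have c: "u * cnj u = 1" "v * cnj v = 1" "w * cnj w = 1" using assms by (auto intro: unit_mult_cnj)
  have "complex_of_real ((norm (u + v))\<^sup>2 + (norm (v + w))\<^sup>2 + (norm (w + u))\<^sup>2)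
     = of_real (3 + (norm (u + v + w))\<^sup>2)"
    using c by (simp add: complex_norm_square algebra_simps del: of_real_power)
  then show ?thesis by (simp only: of_real_eq_iff)
qed

lemma obtain_remaining_pair:
  assumes "card C = 5" "i \<in> C" "j \<in> C" "k \<in> C" "i \<noteq> j" "i \<noteq> k" "j \<noteq> k"
  obtains l m where "C = {i,j,k,l,m}" "distinct [i,j,k,l,m]"
proof -
  have fin: "finite C" using assms(1) by (metis card.infinite zero_neq_numeral)
  have "card (C - {i,j,k}) = 2"
    using assms by (subst card_Diff_subset) auto
  then obtain l m where lm: "C - {i,j,k} = {l,m}" "l \<noteq> m" by (auto simp: card_2_iff)
  have "C = {i,j,k} \<union> (C - {i,j,k})" using assms by auto
  then have "C = {i,j,k,l,m}" unfolding lm by auto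
  moreover have "l \<notin> {i,j,k}" "m \<notin> {i,j,k}" using lm by blast+
  ultimately show ?thesis using that lm assms by auto
qed

text \<open>The six terms of the permutation sum split into even and odd ones. By perm_sum_eq the sum is real, for
  the matrix and for its transpose, and transposing conjugates the even terms only; hence the even and the
  odd part are both real.\<close>
lemma hadamard5_triple:
  assumes H: "complex_hadamard R C W" and C5: "card C = 5"
    and R: "p \<in> R" "q \<in> R" "r \<in> R" "p \<noteq> q" "p \<noteq> r" "q \<noteq> r"
    and C: "i \<in> C" "j \<in> C" "k \<in> C" "i \<noteq> j" "i \<noteq> k" "j \<noteq> k"
  defines "a \<equiv> \<lambda>t. W q t * cnj (W p t)" and "b \<equiv> \<lambda>t. W r t * cnj (W q t)"
    and "c \<equiv> \<lambda>t. W p t * cnj (W r t)"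
  shows "a i * b j * c k = 1 \<or> a j * b k * c i = 1 \<or> a k * b i * c j = 1"
    and "Re (perm_sum a b c i j k) \<ge> -2"
proof -
  have fin: "finite R" "finite C" and cd: "card R = card C"
    and n1: "\<And>p i. p \<in> R \<Longrightarrow> i \<in> C \<Longrightarrow> norm (W p i) = 1"
    and orth: "\<And>p q. p \<in> R \<Longrightarrow> q \<in> R \<Longrightarrow> p \<noteq> q \<Longrightarrow> (\<Sum>i\<in>C. W p i * cnj (W q i)) = 0"
    using H by (auto simp: complex_hadamard_def)
  have corth: "\<And>i j. i \<in> C \<Longrightarrow> j \<in> C \<Longrightarrow> i \<noteq> j \<Longrightarrow> (\<Sum>p\<in>R. W p i * cnj (W p j)) = 0"
    using complex_hadamard_transpose[OF H] by (auto simp: complex_hadamard_def)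
  have u: "W p i * cnj (W p i) = 1" if "p \<in> R" "i \<in> C" for p i
    using n1[OF that] by (rule unit_mult_cnj)
  obtain l m where lm: "C = {i,j,k,l,m}" "distinct [i,j,k,l,m]"
    using obtain_remaining_pair[OF C5 C] .
  obtain s t where st: "R = {p,q,r,s,t}" "distinct [p,q,r,s,t]"
    using obtain_remaining_pair[of R, OF _ R] cd C5 by auto
  define a' where "a' = (\<lambda>x. W x j * cnj (W x i))"
  define b' where "b' = (\<lambda>x. W x k * cnj (W x j))"
  define c' where "c' = (\<lambda>x. W x i * cnj (W x k))"
  have na: "norm (a x) = 1" "norm (b x) = 1" "norm (c x) = 1" if "x \<in> C" for x
    using that R n1 by (simp_all add: a_def b_def c_def norm_mult)
  have na': "norm (a' x) = 1" "norm (b' x) = 1" "norm (c' x) = 1" if "x \<in> R" for x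
    using that C n1 by (simp_all add: a'_def b'_def c'_def norm_mult)
  have abc: "a x * b x * c x = 1" if "x \<in> C" for x
    using u[OF R(1) that] u[OF R(2) that] u[OF R(3) that] unfolding a_def b_def c_def by algebra
  have abc': "a' x * b' x * c' x = 1" if "x \<in> R" for x
    using u[OF that C(1)] u[OF that C(2)] u[OF that C(3)] unfolding a'_def b'_def c'_def by algebra
  have sC: "f i + f j + f k + f l + f m = sum f C" for f :: "_ \<Rightarrow> complex"
    using lm by (simp add: add_ac)
  have sR: "f p + f q + f r + f s + f t = sum f R" for f :: "_ \<Rightarrow> complex"
    using st by (simp add: add_ac)
  have z: "sum a C = 0" "sum b C = 0" "sum c C = 0"
    using R by (auto simp: a_def b_def c_def orth)
  have z': "sum a' R = 0" "sum b' R = 0" "sum c' R = 0"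
    using C by (auto simp: a'_def b'_def c'_def corth)
  have "Im (perm_sum a b c i j k) = 0"
    by (subst perm_sum_eq[where l = l and m = m])
      (simp_all only: lm(1)[symmetric] na abc sC z Im_complex_of_real)
  moreover have "Im (perm_sum a' b' c' p q r) = 0"
    by (subst perm_sum_eq[where l = s and m = t])
      (simp_all only: st(1)[symmetric] na' abc' sR z' Im_complex_of_real)
  moreover have "perm_sum a' b' c' p q r =
     cnj (a i * b j * c k + a j * b k * c i + a k * b i * c j) +
     (a i * b k * c j + a k * b j * c i + a j * b i * c k)"
    unfolding perm_sum_def a'_def b'_def c'_def a_def b_def c_def by (simp add: mult_ac add_ac)
  moreover have ps: "perm_sum a b c i j k =
     (a i * b j * c k + a j * b k * c i + a k * b i * c j) +
     (a i * b k * c j + a k * b j * c i + a j * b i * c k)"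
    unfolding perm_sum_def by (simp add: add_ac)
  ultimately have im: "Im (a i * b j * c k + a j * b k * c i + a k * b i * c j) = 0"
    "Im (a i * b k * c j + a k * b j * c i + a j * b i * c k) = 0"
    by (simp_all only: plus_complex.sel cnj.sel; linarith)+
  have nT: "norm (a x * b y * c z) = 1" if "x \<in> C" "y \<in> C" "z \<in> C" for x y z
    using that na by (simp add: norm_mult)
  have p1: "(a i * b j * c k) * (a j * b k * c i) * (a k * b i * c j) = 1"
    "(a i * b k * c j) * (a k * b j * c i) * (a j * b i * c k) = 1"
    using abc[OF C(1)] abc[OF C(2)] abc[OF C(3)] by algebra+
  note P = unit_product_real_sum[OF nT nT nT p1(1) im(1), OF C(1-3) C(2,3,1) C(3,1,2)]
  note Q = unit_product_real_sum[OF nT nT nT p1(2) im(2), OF C(1,3,2) C(3,2,1) C(2,1,3)]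
  show "a i * b j * c k = 1 \<or> a j * b k * c i = 1 \<or> a k * b i * c j = 1" by (rule P(1))
  show "Re (perm_sum a b c i j k) \<ge> -2" using P(2) Q(2) unfolding ps by simp
qed

text \<open>Makes the entries of a quotient of two rows distinct. If two rows agreed in the ratio of
  columns l and m, orthogonality of these columns would give the other three ratios a sum of norm 2,
  hence 3 + 4 = 7 for their pairwise squared norms. The permanent would be 10 - 14 = -4 by
  \<open>perm_sum_eq\<close>, below the bound -2 of \<open>hadamard5_triple\<close>.\<close>

lemma hadamard5_cross_ratio:
  assumes H: "complex_hadamard R C W" and C5: "card C = 5"
    and R: "s \<in> R" "t \<in> R" "s \<noteq> t" and C: "l \<in> C" "m \<in> C" "l \<noteq> m"
  shows "W s l * cnj (W s m) \<noteq> W t l * cnj (W t m)"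
proof
  assume eq: "W s l * cnj (W s m) = W t l * cnj (W t m)"
  have fin: "finite R" "finite C" and cd: "card R = card C"
    and n1: "\<And>p i. p \<in> R \<Longrightarrow> i \<in> C \<Longrightarrow> norm (W p i) = 1"
    and orth: "\<And>p q. p \<in> R \<Longrightarrow> q \<in> R \<Longrightarrow> p \<noteq> q \<Longrightarrow> (\<Sum>i\<in>C. W p i * cnj (W q i)) = 0"
    using H by (auto simp: complex_hadamard_def)
  have corth: "\<And>i j. i \<in> C \<Longrightarrow> j \<in> C \<Longrightarrow> i \<noteq> j \<Longrightarrow> (\<Sum>p\<in>R. W p i * cnj (W p j)) = 0"
    using complex_hadamard_transpose[OF H] by (auto simp: complex_hadamard_def)
  have u: "W p i * cnj (W p i) = 1" if "p \<in> R" "i \<in> C" for p i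
    using n1[OF that] by (rule unit_mult_cnj)
  have "card (R - {s,t}) = 3" using R cd C5 fin by (subst card_Diff_subset) auto
  then obtain r where "r \<in> R - {s,t}" by (metis card.empty equals0I zero_neq_numeral)
  then have r: "r \<in> R" "s \<noteq> r" "t \<noteq> r" by auto
  obtain p q where pq: "R = {s,t,r,p,q}" "distinct [s,t,r,p,q]"
    using obtain_remaining_pair[of R s t r] cd C5 R r by auto
  have p: "p \<in> R" "q \<in> R" using pq by auto
  have "card (C - {l,m}) = 3" using C C5 fin by (subst card_Diff_subset) auto
  then obtain k where "k \<in> C - {l,m}" by (metis card.empty equals0I zero_neq_numeral)
  then have k: "k \<in> C" "l \<noteq> k" "m \<noteq> k" by auto
  obtain i j where ij: "C = {l,m,k,i,j}" "distinct [l,m,k,i,j]"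
    using obtain_remaining_pair[of C l m k] C5 C k by auto
  define \<rho> where "\<rho> = (\<lambda>x. W x l * cnj (W x m))"
  define a where "a = (\<lambda>t. W q t * cnj (W p t))"
  define b where "b = (\<lambda>t. W r t * cnj (W q t))"
  define c where "c = (\<lambda>t. W p t * cnj (W r t))"
  have n\<rho>: "norm (\<rho> x) = 1" if "x \<in> R" for x using that C n1 by (simp add: \<rho>_def norm_mult)
  have "\<rho> p + \<rho> q + \<rho> r + \<rho> s + \<rho> t = 0"
    using corth[OF C] pq by (simp add: \<rho>_def add_ac)
  moreover have "\<rho> s = \<rho> t" using eq by (simp add: \<rho>_def)
  ultimately have "\<rho> p + \<rho> q + \<rho> r = - (2 * \<rho> s)" by (simp add: eq_neg_iff_add_eq_0 algebra_simps)
  then have "norm (\<rho> p + \<rho> q + \<rho> r) = 2" using n\<rho>[OF R(1)] by (simp add: norm_mult)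
  then have seven: "(norm (\<rho> p + \<rho> q))\<^sup>2 + (norm (\<rho> q + \<rho> r))\<^sup>2 + (norm (\<rho> r + \<rho> p))\<^sup>2 = 7"
    using norm_pair_sums[of "\<rho> p" "\<rho> q" "\<rho> r"] n\<rho> pq by simp
  \<comment> \<open>Passes from row quotients, which enter \<open>perm_sum_eq\<close>, to the column
    ratios \<open>\<rho>\<close>: the two sums differ by a unimodular factor.\<close>
  have two: "norm (W y l * cnj (W x l) + W y m * cnj (W x m)) = norm (\<rho> x + \<rho> y)"
    if "x \<in> R" "y \<in> R" for x y
  proof -
    have "W y l * cnj (W x l) + W y m * cnj (W x m) = W y m * cnj (W x l) * (\<rho> x + \<rho> y)"
      using u[OF that(1) C(1)] u[OF that(2) C(2)] unfolding \<rho>_def by algebra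
    then show ?thesis using that C n1 by (simp add: norm_mult)
  qed
  have sC: "f i + f j + f k + f l + f m = sum f C" for f :: "_ \<Rightarrow> complex"
    using ij by (simp add: add_ac)
  have na: "norm (a x) = 1" "norm (b x) = 1" "norm (c x) = 1" if "x \<in> C" for x
    using that pq n1 by (simp_all add: a_def b_def c_def norm_mult)
  have abc: "a x * b x * c x = 1" if "x \<in> C" for x
    using u[OF p(1) that] u[OF p(2) that] u[OF r(1) that]
    unfolding a_def b_def c_def by algebra
  have CC: "{i,j,k,l,m} = C" using ij(1) by auto
  have z: "sum a C = 0" "sum b C = 0" "sum c C = 0"
    using p r pq by (auto simp: a_def b_def c_def orth)
  have "perm_sum a b c i j k =
    of_real (10 - 2 * ((norm (a l + a m))\<^sup>2 + (norm (b l + b m))\<^sup>2 + (norm (c l + c m))\<^sup>2))"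
    by (rule perm_sum_eq) (simp_all only: CC sC z na abc)
  also have "(norm (a l + a m))\<^sup>2 + (norm (b l + b m))\<^sup>2 + (norm (c l + c m))\<^sup>2 = 7"
    using seven two pq by (simp add: a_def b_def c_def)
  finally have "Re (perm_sum a b c i j k) = - 4" by simp
  moreover have "Re (perm_sum a b c i j k) \<ge> - 2"
    unfolding a_def b_def c_def by (rule hadamard5_triple[OF H C5]) (use pq ij in auto)
  ultimately show False by simp
qed

section \<open>Labelled directed edges on five points\<close>

text \<open>There are 60 triples of distinct points, and each has a rotation in F; since F injects into
  the 20 directed edges, equality holds everywhere.\<close>
lemma triangle_condition_successor:
  fixes M :: "'c \<Rightarrow> 'c \<Rightarrow> 'a"
  assumes C5: "card C = 5"
    and out: "\<And>i j k. \<lbrakk>i \<in> C; j \<in> C; k \<in> C; M i j = M i k\<rbrakk> \<Longrightarrow> j = k"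
    and tri: "\<And>i j k. \<lbrakk>i \<in> C; j \<in> C; k \<in> C; i \<noteq> j; i \<noteq> k; j \<noteq> k\<rbrakk>
      \<Longrightarrow> M i j = M j k \<or> M j k = M k i \<or> M k i = M i j"
  shows "\<And>i j. \<lbrakk>i \<in> C; j \<in> C; i \<noteq> j\<rbrakk> \<Longrightarrow> \<exists>k\<in>C - {i,j}. M i j = M j k"
    and "\<And>i j k. \<lbrakk>i \<in> C; j \<in> C; k \<in> C; i \<noteq> j; i \<noteq> k; j \<noteq> k\<rbrakk>
      \<Longrightarrow> \<not> (M i j = M j k \<and> M j k = M k i)"
proof -
  have fin: "finite C" using C5 by (metis card.infinite zero_neq_numeral)
  define E where "E = (SIGMA i:C. C - {i})"
  define D where "D = (SIGMA i:C. SIGMA j:C - {i}. C - {i,j})"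
  \<comment> \<open>The paths of two edges with equal label; by \<open>out\<close> the first edge
    determines the second.\<close>
  define F where "F = {(i,j,k) \<in> D. M i j = M j k}"
  define rot :: "'c \<times> 'c \<times> 'c \<Rightarrow> 'c \<times> 'c \<times> 'c" where "rot = (\<lambda>(i,j,k). (j,k,i))"
  have finD: "finite D" and finE: "finite E" using fin by (auto simp: D_def E_def)
  have finF: "finite F" using finD by (rule finite_subset[rotated]) (auto simp: F_def)
  have c3: "card (C - {i,j}) = 3" if "i \<in> C" "j \<in> C - {i}" for i j
    using that C5 fin by (subst card_Diff_subset) auto
  have c4: "card (C - {i}) = 4" if "i \<in> C" for i using that C5 fin by simp
  have cE: "card E = 20" using fin c4 C5 by (simp add: E_def)
  have cD: "card D = 60" using fin c3 c4 C5 by (simp add: D_def)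
  have cov: "D \<subseteq> F \<union> rot ` F \<union> rot ` rot ` F"
  proof
    fix z assume z: "z \<in> D"
    obtain i j k where ijk: "z = (i,j,k)" by (cases z) auto
    have d: "i \<in> C" "j \<in> C" "k \<in> C" "i \<noteq> j" "i \<noteq> k" "j \<noteq> k" using z ijk by (auto simp: D_def)
    consider "M i j = M j k" | "M j k = M k i" | "M k i = M i j" using tri[OF d] by blast
    then show "z \<in> F \<union> rot ` F \<union> rot ` rot ` F"
    proof cases
      case 1 then show ?thesis using z ijk by (auto simp: F_def)
    next
      case 2
      then have "(j,k,i) \<in> F" using d by (auto simp: F_def D_def)
      moreover have "z = rot (rot (j,k,i))" by (simp add: ijk rot_def)
      ultimately show ?thesis by blast
    next
      case 3
      then have "(k,i,j) \<in> F" using d by (auto simp: F_def D_def)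
      moreover have "z = rot (k,i,j)" by (simp add: ijk rot_def)
      ultimately show ?thesis by blast
    qed
  qed
  have cr: "card (rot ` X) \<le> card X" if "finite X" for X using that by (rule card_image_le)
  have inj: "inj_on (\<lambda>(i,j,k). (i,j)) F"
  proof (rule inj_onI)
    fix z z' assume z: "z \<in> F" "z' \<in> F" "(\<lambda>(i,j,k). (i,j)) z = (\<lambda>(i,j,k). (i,j)) z'"
    obtain i j k k' where e: "z = (i,j,k)" "z' = (i,j,k')" using z(3) by (cases z, cases z') auto
    then have "k = k'" using z(1,2) by (intro out[of j]) (auto simp: F_def D_def)
    then show "z = z'" by (simp add: e)
  qed
  have sub: "(\<lambda>(i,j,k). (i,j)) ` F \<subseteq> E" by (auto simp: F_def D_def E_def)
  have le: "card F \<le> 20" using card_inj_on_le[OF inj sub finE] cE by simp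
  have "60 \<le> card (F \<union> rot ` F \<union> rot ` rot ` F)"
    using card_mono[OF _ cov] finF cD by simp
  also have "\<dots> \<le> card (F \<union> rot ` F) + card (rot ` rot ` F)" by (rule card_Un_le)
  finally have sixty: "60 \<le> card (F \<union> rot ` F) + card (rot ` rot ` F)" .
  have cF1: "card (rot ` F) \<le> 20" and cF2: "card (rot ` rot ` F) \<le> 20"
    using cr[of F] cr[of "rot ` F"] finF le by auto
  have "card F = 20" using sixty cF1 cF2 le card_Un_le[of F "rot ` F"] by linarith
  then have img: "(\<lambda>(i,j,k). (i,j)) ` F = E"
    by (intro card_subset_eq finE sub) (simp add: card_image[OF inj] cE)
  show "\<exists>k\<in>C - {i,j}. M i j = M j k" if "i \<in> C" "j \<in> C" "i \<noteq> j" for i j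
  proof -
    have "(i,j) \<in> (\<lambda>(i,j,k). (i,j)) ` F" unfolding img using that by (auto simp: E_def)
    then show ?thesis by (auto simp: F_def D_def)
  qed
  show "\<not> (M i j = M j k \<and> M j k = M k i)"
    if d: "i \<in> C" "j \<in> C" "k \<in> C" "i \<noteq> j" "i \<noteq> k" "j \<noteq> k" for i j k
  proof
    assume eq: "M i j = M j k \<and> M j k = M k i"
    have "(i,j,k) \<in> F" "(j,k,i) \<in> F" using d eq by (auto simp: F_def D_def)
    moreover have "(j,k,i) = rot (i,j,k)" by (simp add: rot_def)
    ultimately have "(j,k,i) \<in> F \<inter> rot ` F" by blast
    \<comment> \<open>A common point leaves at most 39 elements in the union of F and its rotation,
      while the count requires 60 - 20 = 40.\<close>
    then have "card (F \<inter> rot ` F) > 0" using finF by (auto simp: card_gt_0_iff)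
    moreover have "card F + card (rot ` F) = card (F \<union> rot ` F) + card (F \<inter> rot ` F)"
      using finF by (intro card_Un_Int) auto
    ultimately show False using sixty cF1 cF2 le by linarith
  qed
qed

text \<open>Read x i * y j as the label of the edge from i to j. By \<open>succ\<close> an edge with
  label c is followed by another one with label c that does not turn back, and by
  \<open>notri\<close> this walk does not close after three edges, so it visits at least four
  points. Every visited t has an edge with label c leaving it. The choice s = t is allowed, and it
  is what happens at a point that the walk misses.\<close>

lemma product_label_in_row:
  fixes x y :: "'c \<Rightarrow> complex"
  assumes C5: "card C = 5"
    and nz: "\<And>i. i \<in> C \<Longrightarrow> x i \<noteq> 0"
    and sy: "sum y C = 0" and sx: "(\<Sum>i\<in>C. inverse (x i)) = 0"
    and succ: "\<And>i j. \<lbrakk>i \<in> C; j \<in> C; i \<noteq> j\<rbrakk> \<Longrightarrow> \<exists>k\<in>C - {i,j}. x i * y j = x j * y k"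
    and notri: "\<And>i j k. \<lbrakk>i \<in> C; j \<in> C; k \<in> C; i \<noteq> j; i \<noteq> k; j \<noteq> k\<rbrakk>
      \<Longrightarrow> \<not> (x i * y j = x j * y k \<and> x j * y k = x k * y i)"
    and v01: "v0 \<in> C" "v1 \<in> C" "v0 \<noteq> v1" and t: "t \<in> C"
  shows "\<exists>s\<in>C. x t * y s = x v0 * y v1"
proof -
  have fin: "finite C" using C5 by (metis card.infinite zero_neq_numeral)
  define c where "c = x v0 * y v1"
  have step: "\<exists>k\<in>C. k \<noteq> i \<and> k \<noteq> j \<and> x j * y k = c"
    if "i \<in> C" "j \<in> C" "i \<noteq> j" "x i * y j = c" for i j
    using succ[OF that(1-3)] that(4) by (metis DiffE insertCI)
  obtain v2 where v2: "v2 \<in> C" "v2 \<noteq> v0" "v2 \<noteq> v1" "x v1 * y v2 = c"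
    using step[OF v01] by (auto simp: c_def)
  obtain v3 where v3: "v3 \<in> C" "v3 \<noteq> v1" "v3 \<noteq> v2" "x v2 * y v3 = c"
    using step[of v1 v2] v01 v2 by blast
  have v30: "v3 \<noteq> v0" using notri[of v0 v1 v2] v01 v2 v3 unfolding c_def by metis
  obtain v4 where v4: "v4 \<in> C" "v4 \<noteq> v2" "v4 \<noteq> v3" "x v3 * y v4 = c"
    using step[of v2 v3] v2 v3 by blast
  have v41: "v4 \<noteq> v1" using notri[of v1 v2 v3] v01 v2 v3 v4 by metis
  have full: "C = {v0,v1,v2,v3,m}" if "m \<in> C - {v0,v1,v2,v3}" for m
  proof (rule card_subset_eq[symmetric, OF fin])
    show "{v0,v1,v2,v3,m} \<subseteq> C" using that v01 v2 v3 by auto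
    show "card {v0,v1,v2,v3,m} = card C" using that v01 v2 v3 v30 C5 by auto
  qed
  have "card (C - {v0,v1,v2,v3}) = 1"
    using v01 v2 v3 v30 C5 fin by (subst card_Diff_subset) auto
  then obtain m where "m \<in> C - {v0,v1,v2,v3}" by (auto simp: card_1_singleton_iff)
  then have m: "C = {v0,v1,v2,v3,m}" "m \<notin> {v0,v1,v2,v3}" "m \<in> C" using full by auto
  have "distinct [v0,v1,v2,v3,m]" using v01 v2 v3 v30 m by auto
  then have sC: "sum f C = f v0 + f v1 + f v2 + f v3 + f m" for f :: "'c \<Rightarrow> complex"
    using m(1) by (simp add: add_ac)
  \<comment> \<open>The edges with label c form a cycle through all of C, or a 4-cycle missing one point m; in the
    latter case the vanishing sums give the missing value.\<close>
  have "\<exists>s\<in>C. x m * y s = c"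
  proof (cases "v4 = v0")
    case True
    have "y v1 = c * inverse (x v0)" "y v2 = c * inverse (x v1)"
      "y v3 = c * inverse (x v2)" "y v0 = c * inverse (x v3)"
      using v01 v2 v3 v4 True nz by (auto simp: c_def field_simps)
    moreover have "y v0 + y v1 + y v2 + y v3 + y m = 0"
      using sy unfolding sC .
    moreover have "inverse (x v0) + inverse (x v1) + inverse (x v2) + inverse (x v3) + inverse (x m) = 0"
      using sx unfolding sC .
    ultimately have "y m = c * inverse (x m)" by algebra
    then show ?thesis using m nz by (auto intro!: bexI[of _ m])
  next
    case False
    then have "v4 = m" using v4 v41 m by auto
    then show ?thesis using step[of v3 m] v3 v4 m by blast
  qed
  moreover have "x v0 * y v1 = c" by (simp add: c_def)
  moreover have "t = v0 \<or> t = v1 \<or> t = v2 \<or> t = v3 \<or> t = m" using t m(1) by auto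
  ultimately have "\<exists>s\<in>C. x t * y s = c" using v01 v2 v3 v4 by blast
  then show ?thesis by (simp add: c_def)
qed

text \<open>The edges yield only the products with distinct indices, so the common part L of the
  rows Z t may have 4 elements instead of 5. In that case the fifth element is the same in all rows
  because every row sums to 0. Equal rows have equal products, and the product over Z t contains x t
  five times.\<close>

lemma triangle_condition_fifth_powers:
  fixes x y :: "'c \<Rightarrow> complex"
  assumes C5: "card C = 5"
    and nzx: "\<And>i. i \<in> C \<Longrightarrow> x i \<noteq> 0" and nzy: "\<And>i. i \<in> C \<Longrightarrow> y i \<noteq> 0"
    and injy: "inj_on y C"
    and sy: "sum y C = 0" and sx: "(\<Sum>i\<in>C. inverse (x i)) = 0"
    and tri: "\<And>i j k. \<lbrakk>i \<in> C; j \<in> C; k \<in> C; i \<noteq> j; i \<noteq> k; j \<noteq> k\<rbrakk>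
      \<Longrightarrow> x i * y j = x j * y k \<or> x j * y k = x k * y i \<or> x k * y i = x i * y j"
    and ij: "t \<in> C" "u \<in> C"
  shows "x t ^ 5 = x u ^ 5"
proof -
  have fin: "finite C" using C5 by (metis card.infinite zero_neq_numeral)
  have out: "j = k" if "i \<in> C" "j \<in> C" "k \<in> C" "x i * y j = x i * y k" for i j k
    using that nzx injy by (auto dest: inj_onD)
  note st = triangle_condition_successor[where M = "\<lambda>i j. x i * y j", OF C5 out tri]
  define L where "L = {x i * y j | i j. i \<in> C \<and> j \<in> C \<and> i \<noteq> j}"
  define Z where "Z = (\<lambda>t. (\<lambda>s. x t * y s) ` C)"
  have injZ: "inj_on (\<lambda>s. x t * y s) C" if "t \<in> C" for t
    using out that by (auto intro!: inj_onI)
  have LZ: "L \<subseteq> Z t" if t: "t \<in> C" for t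
  proof
    fix z assume "z \<in> L"
    then obtain i j where "z = x i * y j" "i \<in> C" "j \<in> C" "i \<noteq> j" by (auto simp: L_def)
    moreover from this have "\<exists>s\<in>C. x t * y s = x i * y j"
      by (intro product_label_in_row[OF C5 nzx sy sx st]) (use t in auto)
    ultimately show "z \<in> Z t" unfolding Z_def by (metis image_eqI)
  qed
  have finZ: "finite (Z t)" for t using fin by (simp add: Z_def)
  have cZ: "card (Z t) = 5" if "t \<in> C" for t
    unfolding Z_def using card_image[OF injZ[OF that]] C5 by simp
  have sZ: "sum id (Z t) = 0" if "t \<in> C" for t
    unfolding Z_def using sum.reindex[OF injZ[OF that], of id] sy by (simp add: sum_distrib_left[symmetric])
  have finL: "finite L" using LZ[OF ij(1)] finZ by (rule finite_subset)
  have "(\<lambda>s. x t * y s) ` (C - {t}) \<subseteq> L" using ij by (auto simp: L_def)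
  then have "card ((\<lambda>s. x t * y s) ` (C - {t})) \<le> card L" using finL by (intro card_mono)
  moreover have "card ((\<lambda>s. x t * y s) ` (C - {t})) = 4"
    using card_image[OF inj_on_subset[OF injZ[OF ij(1)], of "C - {t}"]] C5 ij fin by auto
  ultimately have cL: "card L \<ge> 4" by simp
  have cD: "card (Z t - L) = 5 - card L" if "t \<in> C" for t
    using LZ[OF that] finL cZ[OF that] by (simp add: card_Diff_subset)
  have sD: "sum id (Z t - L) = - sum id L" if "t \<in> C" for t
    using sum.subset_diff[OF LZ[OF that] finZ, of id] sZ[OF that] by (simp add: eq_neg_iff_add_eq_0)
  have "Z t - L = Z u - L"
  proof (cases "card L = 5")
    case True
    then show ?thesis using cD[OF ij(1)] cD[OF ij(2)] finZ by auto
  next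
    case False
    moreover have "card L \<le> 5" using card_mono[OF finZ LZ[OF ij(1)]] cZ[OF ij(1)] by simp
    ultimately have "card (Z t - L) = 1" "card (Z u - L) = 1"
      using cL cD[OF ij(1)] cD[OF ij(2)] by auto
    then obtain z z' where "Z t - L = {z}" "Z u - L = {z'}" by (auto simp: card_1_singleton_iff)
    then show ?thesis using sD[OF ij(1)] sD[OF ij(2)] by simp
  qed
  then have "Z t = Z u" using LZ[OF ij(1)] LZ[OF ij(2)] by blast
  moreover have "prod id (Z t) = x t ^ 5 * prod y C" if "t \<in> C" for t
    unfolding Z_def using prod.reindex[OF injZ[OF that], of id] C5 by (simp add: prod.distrib)
  ultimately have "x t ^ 5 * prod y C = x u ^ 5 * prod y C" using ij by metis
  moreover have "prod y C \<noteq> 0" using nzy fin by simp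
  ultimately show ?thesis by simp
qed

theorem hadamard5_fifth_powers:
  assumes H: "complex_hadamard R C W" and C5: "card C = 5"
  shows "\<exists>p\<in>R. \<exists>q\<in>R. inj_on (\<lambda>i. W q i * cnj (W p i)) C \<and>
    (\<forall>i\<in>C. \<forall>j\<in>C. (W q i * cnj (W p i)) ^ 5 = (W q j * cnj (W p j)) ^ 5)"
proof -
  have fin: "finite R" "finite C" and cd: "card R = card C"
    and n1: "\<And>p i. p \<in> R \<Longrightarrow> i \<in> C \<Longrightarrow> norm (W p i) = 1"
    and orth: "\<And>p q. p \<in> R \<Longrightarrow> q \<in> R \<Longrightarrow> p \<noteq> q \<Longrightarrow> (\<Sum>i\<in>C. W p i * cnj (W q i)) = 0"
    using H by (auto simp: complex_hadamard_def)
  have u: "W p i * cnj (W p i) = 1" if "p \<in> R" "i \<in> C" for p i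
    using n1[OF that] by (rule unit_mult_cnj)
  obtain S where S: "S \<subseteq> R" "card S = 3"
    by (rule obtain_subset_with_card_n[of 3 R]) (use cd C5 in auto)
  then obtain p q r where "S = {p,q,r}" "p \<noteq> q" "p \<noteq> r" "q \<noteq> r" by (auto simp: card_3_iff)
  with S have pqr: "p \<in> R" "q \<in> R" "r \<in> R" "p \<noteq> q" "p \<noteq> r" "q \<noteq> r" by auto
  define x where "x = (\<lambda>t. W q t * cnj (W p t))"
  define y where "y = (\<lambda>t. W r t * cnj (W p t))"
  have nx: "norm (x i) = 1" "norm (y i) = 1" if "i \<in> C" for i
    using that pqr n1 by (simp_all add: x_def y_def norm_mult)
  have nz: "x i \<noteq> 0" "y i \<noteq> 0" if "i \<in> C" for i using nx[OF that] by auto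
  have inv: "inverse (x i) = W p i * cnj (W q i)" if "i \<in> C" for i
    using u[OF pqr(1) that] u[OF pqr(2) that] unfolding x_def by (intro inverse_unique) algebra
  have inj: "inj_on (\<lambda>t. W q t * cnj (W p t)) C" if "q \<in> R" "p \<in> R" "p \<noteq> q" for p q
  proof (rule inj_onI, rule ccontr)
    fix i j assume ij: "i \<in> C" "j \<in> C" "W q i * cnj (W p i) = W q j * cnj (W p j)" "i \<noteq> j"
    have "W q i * cnj (W q j) = W p i * cnj (W p j)"
      using ij(3) u[OF that(1) ij(2)] u[OF that(2) ij(1)] by algebra
    then show False using hadamard5_cross_ratio[OF H C5 that(1,2) that(3)[symmetric] ij(1,2,4)] by auto
  qed
  have "x t ^ 5 = x u ^ 5" if "t \<in> C" "u \<in> C" for t u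
  proof (rule triangle_condition_fifth_powers[where x = x and y = y, OF C5 nz _ _ _ _ that])
    show "inj_on y C" unfolding y_def using pqr by (intro inj)
    show "sum y C = 0" unfolding y_def using pqr by (intro orth) auto
    show "(\<Sum>i\<in>C. inverse (x i)) = 0" using pqr by (simp add: inv orth)
    fix i j k assume C: "i \<in> C" "j \<in> C" "k \<in> C" "i \<noteq> j" "i \<noteq> k" "j \<noteq> k"
    \<comment> \<open>With x = q/p and y = r/p the assumption reads x i * (y j / x j) / y k = 1, so
      an even term of the permanent equal to 1 is one alternative of the triangle condition.\<close>
    have *: "x i * y j = x j * y k"
      if "(W q i * cnj (W p i)) * (W r j * cnj (W q j)) * (W p k * cnj (W r k)) = 1"
        and C: "i \<in> C" "j \<in> C" "k \<in> C" for i j k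
      using that(1) u[OF pqr(1) C(1)] u[OF pqr(1) C(2)] u[OF pqr(1) C(3)]
        u[OF pqr(2) C(2)] u[OF pqr(3) C(3)]
      unfolding x_def y_def by algebra
    show "x i * y j = x j * y k \<or> x j * y k = x k * y i \<or> x k * y i = x i * y j"
      using hadamard5_triple(1)[OF H C5 pqr C] *[of i j k] *[of j k i] *[of k i j] C by metis
  qed auto
  then show ?thesis using inj[of q p] pqr unfolding x_def by blast
qed

section \<open>Hadamard matrices of orders 2, 3 and 4\<close>

lemma hadamard_order_2_3_powers:
  assumes "complex_hadamard R C W" and "card C = 2 \<or> card C = 3"
  shows "\<exists>p\<in>R. \<exists>q\<in>R. inj_on (\<lambda>i. W q i * cnj (W p i)) C \<and>
    (\<forall>i\<in>C. \<forall>j\<in>C. (W q i * cnj (W p i)) ^ card C = (W q j * cnj (W p j)) ^ card C)"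
proof -
  have fin: "finite R" "finite C" and cd: "card R = card C"
    and n1: "\<And>p i. p \<in> R \<Longrightarrow> i \<in> C \<Longrightarrow> norm (W p i) = 1"
    and orth: "\<And>p q. p \<in> R \<Longrightarrow> q \<in> R \<Longrightarrow> p \<noteq> q \<Longrightarrow> (\<Sum>i\<in>C. W p i * cnj (W q i)) = 0"
    using assms(1) by (auto simp: complex_hadamard_def)
  have "2 \<le> card R" using assms(2) unfolding cd by auto
  then obtain S where S: "S \<subseteq> R" "card S = 2" by (rule obtain_subset_with_card_n)
  then obtain p q where pq: "p \<in> R" "q \<in> R" "p \<noteq> q" by (auto simp: card_2_iff)
  define x where "x = (\<lambda>i. W q i * cnj (W p i))"
  have nx: "norm (x i) = 1" if "i \<in> C" for i
    using that pq n1 by (simp add: x_def norm_mult)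
  have ux: "x i * cnj (x i) = 1" if "i \<in> C" for i
    using nx[OF that] by (rule unit_mult_cnj)
  have sx: "sum x C = 0" using orth[of q p] pq by (simp add: x_def)
  have "inj_on x C \<and> (\<forall>i\<in>C. \<forall>j\<in>C. x i ^ card C = x j ^ card C)"
  proof (cases "card C = 2")
    case True
    then obtain i j where C: "C = {i,j}" "i \<noteq> j" by (auto simp: card_2_iff)
    have "x i + x j = 0" using sx C by simp
    moreover have "x i \<noteq> 0" using nx C by fastforce
    ultimately show ?thesis using C True by (auto simp: add_eq_0_iff2 inj_on_def)
  next
    case False
    then have C3: "card C = 3" using assms(2) by simp
    then obtain i j k where C: "C = {i,j,k}" "i \<noteq> j" "i \<noteq> k" "j \<noteq> k" by (auto simp: card_3_iff)
    have s: "x i + x j + x k = 0" using sx C by (simp add: add_ac)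
    have s': "cnj (x i) + cnj (x j) + cnj (x k) = 0" using arg_cong[OF s, of cnj] by simp
    have u: "x i * cnj (x i) = 1" "x j * cnj (x j) = 1" "x k * cnj (x k) = 1" using ux C by auto
    \<comment> \<open>The conjugate sum multiplied by x i * x j * x k is the second elementary
      symmetric function. It vanishes together with the sum, so all three numbers are roots of z^3 =
      x i * x j * x k.\<close>
    have e: "x i ^ 3 = x i * x j * x k" "x j ^ 3 = x i * x j * x k" "x k ^ 3 = x i * x j * x k"
      using s s' u by algebra+
    \<comment> \<open>Two equal summands would force the third to have norm 2.\<close>
    have ne: "a \<noteq> b" if "a + b + c = 0" "norm a = 1" "norm c = 1" for a b c :: complex
    proof
      assume "a = b"
      then have "c = - (2 * a)" using that(1) by (simp add: eq_neg_iff_add_eq_0 add_ac)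
      then show False using that by (simp add: norm_mult)
    qed
    have "x i \<noteq> x j" "x i \<noteq> x k" "x j \<noteq> x k"
      using ne[of "x i" "x j" "x k"] ne[of "x i" "x k" "x j"] ne[of "x j" "x k" "x i"] s nx C
      by (auto simp: add_ac)
    then have "inj_on x C" using C by (auto simp: inj_on_def)
    then show ?thesis using C e unfolding C3 by auto
  qed
  then show ?thesis using pq unfolding x_def by blast
qed

text \<open>Since the sum vanishes, (x + y)(x + z)(x + w) reduces to the third elementary symmetric
  function, which is x * y * z * w times the conjugate of the sum and hence 0.\<close>

lemma four_unit_sum_zero:
  fixes x y z w :: complex
  assumes "norm x = 1" "norm y = 1" "norm z = 1" "norm w = 1" and s: "x + y + z + w = 0"
  shows "(x = - y \<and> z = - w) \<or> (x = - z \<and> y = - w) \<or> (x = - w \<and> y = - z)"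
proof -
  have u: "x * cnj x = 1" "y * cnj y = 1" "z * cnj z = 1" "w * cnj w = 1"
    using assms by (auto intro: unit_mult_cnj)
  have "cnj x + cnj y + cnj z + cnj w = 0" using arg_cong[OF s, of cnj] by simp
  then have "(x + y) * (x + z) * (x + w) = 0" using u s by algebra
  then consider "x + y = 0" | "x + z = 0" | "x + w = 0" by auto
  then show ?thesis
  proof cases
    case 1
    moreover from this have "z + w = 0" using s by simp
    ultimately show ?thesis by (simp add: add_eq_0_iff2)
  next
    case 2
    moreover have "x + y + z + w = (x + z) + (y + w)" by simp
    ultimately have "y + w = 0" using s by simp
    then show ?thesis using 2 by (simp add: add_eq_0_iff2)
  next
    case 3
    moreover have "x + y + z + w = (x + w) + (y + z)" by simp
    ultimately have "y + z = 0" using s by simp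
    then show ?thesis using 3 by (simp add: add_eq_0_iff2)
  qed
qed

text \<open>After division by row p every other row consists of two pairs of opposite values. Two of
  these rows pair a0 with different points; their inner product then factors, which makes one of
  them constant up to sign. This one is \<open>q\<close> in the conclusion. In the other one the
  phase between a0 and a1 stays free.\<close>

lemma hadamard4_sign_rows:
  assumes H: "complex_hadamard R C W" and C4: "card C = 4"
  shows "\<exists>p\<in>R. \<exists>q\<in>R. \<exists>r\<in>R. \<exists>a0 a1 a2 a3. C = {a0,a1,a2,a3} \<and> distinct [a0,a1,a2,a3] \<and>
    W q a1 * cnj (W p a1) = - (W q a0 * cnj (W p a0)) \<and>
    W q a2 * cnj (W p a2) = W q a0 * cnj (W p a0) \<and>
    W q a3 * cnj (W p a3) = - (W q a0 * cnj (W p a0)) \<and>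
    W r a2 * cnj (W p a2) = - (W r a0 * cnj (W p a0)) \<and>
    W r a3 * cnj (W p a3) = - (W r a1 * cnj (W p a1))"
proof -
  have fin: "finite R" "finite C" and cd: "card R = card C"
    and n1: "\<And>p i. p \<in> R \<Longrightarrow> i \<in> C \<Longrightarrow> norm (W p i) = 1"
    and orth: "\<And>p q. p \<in> R \<Longrightarrow> q \<in> R \<Longrightarrow> p \<noteq> q \<Longrightarrow> (\<Sum>i\<in>C. W p i * cnj (W q i)) = 0"
    using H by (auto simp: complex_hadamard_def)
  obtain S where "S \<subseteq> R" "card S = 4"
    by (rule obtain_subset_with_card_n[of 4 R]) (use cd C4 in auto)
  then have "R \<noteq> {}" by auto
  then obtain p where p: "p \<in> R" by blast
  have "card (R - {p}) = 3" using p fin cd C4 by simp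
  then obtain q1 q2 q3 where q: "R - {p} = {q1,q2,q3}" "q1 \<noteq> q2" "q1 \<noteq> q3" "q2 \<noteq> q3"
    by (auto simp: card_3_iff)
  have qR: "q1 \<in> R" "q2 \<in> R" "q3 \<in> R" "q1 \<noteq> p" "q2 \<noteq> p" "q3 \<noteq> p" using q(1) by auto
  have "C \<noteq> {}" using C4 by auto
  then obtain a0 where a0: "a0 \<in> C" by blast
  define X where "X = (\<lambda>q i. W q i * cnj (W p i))"
  have nX: "norm (X q i) = 1" if "q \<in> R" "i \<in> C" for q i
    using that p n1 by (simp add: X_def norm_mult)
  have sX: "sum (X q) C = 0" if "q \<in> R" "q \<noteq> p" for q
    using orth[OF that(1) p that(2)] by (simp add: X_def)
  have oX: "(\<Sum>i\<in>C. X q i * cnj (X r i)) = 0" if "q \<in> R" "r \<in> R" "q \<noteq> r" for q r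
  proof -
    have "X q i * cnj (X r i) = W q i * cnj (W r i)" if "i \<in> C" for i
      using unit_mult_cnj[OF n1[OF p that]] unfolding X_def by simp algebra
    then show ?thesis using orth[OF that] by simp
  qed
  have four: "C = {a0,a,b,c}" if "a \<in> C" "b \<in> C" "c \<in> C" "distinct [a0,a,b,c]" for a b c
    using that a0 C4 by (intro card_subset_eq[symmetric] fin) auto
  \<comment> \<open>The two points outside the pair of a0 and a are opposite as well. It is stated
    for all b and c since these two points have no preferred order.\<close>
  define G where "G = (\<lambda>q a. \<forall>b c. b \<in> C \<longrightarrow> c \<in> C \<longrightarrow> distinct [a0,a,b,c] \<longrightarrow> X q c = - X q b)"
  have pos: "\<exists>a\<in>C - {a0}. X q a = - X q a0 \<and> G q a"
    if q: "q \<in> R" "q \<noteq> p" for q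
  proof -
    have "card (C - {a0}) = 3" using a0 fin C4 by simp
    then obtain a b c where abc: "C - {a0} = {a,b,c}" "a \<noteq> b" "a \<noteq> c" "b \<noteq> c"
      by (auto simp: card_3_iff)
    then have C: "C = {a0,a,b,c}" "a \<noteq> a0" "b \<noteq> a0" "c \<noteq> a0" using a0 by auto
    have "X q a0 + X q a + X q b + X q c = 0"
      using sX[OF q] C abc by (simp add: add_ac)
    then have "(X q a0 = - X q a \<and> X q b = - X q c) \<or> (X q a0 = - X q b \<and> X q a = - X q c) \<or>
        (X q a0 = - X q c \<and> X q a = - X q b)"
      using nX[OF q(1)] C by (intro four_unit_sum_zero) auto
    then show ?thesis
    proof (elim disjE)
      assume "X q a0 = - X q a \<and> X q b = - X q c" then show ?thesis using C abc by (intro bexI[of _ a]) (auto simp: G_def)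
    next
      assume "X q a0 = - X q b \<and> X q a = - X q c" then show ?thesis using C abc by (intro bexI[of _ b]) (auto simp: G_def)
    next
      assume "X q a0 = - X q c \<and> X q a = - X q b" then show ?thesis using C abc by (intro bexI[of _ c]) (auto simp: G_def)
    qed
  qed
  have "\<forall>q. \<exists>a. q \<in> R \<and> q \<noteq> p \<longrightarrow> a \<in> C \<and> a \<noteq> a0 \<and> X q a = - X q a0 \<and> G q a"
    using pos by blast
  from choice[OF this] obtain f where
    f0: "\<forall>q. q \<in> R \<and> q \<noteq> p \<longrightarrow> f q \<in> C \<and> f q \<noteq> a0 \<and> X q (f q) = - X q a0 \<and> G q (f q)" ..
  have f: "f q \<in> C" "f q \<noteq> a0" "X q (f q) = - X q a0" and fG: "G q (f q)"
    if "q \<in> R" "q \<noteq> p" for q using f0 that by auto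
  have f4: "X q c = - X q b"
    if "q \<in> R" "q \<noteq> p" "b \<in> C" "c \<in> C" "distinct [a0,f q,b,c]" for q b c
    using fG[OF that(1,2)] that(3-5) unfolding G_def by blast
  \<comment> \<open>If all three rows paired a0 with the same point, their values at a0 and at one
    point b of the other pair would be three nonzero, mutually orthogonal vectors in a complex
    plane.\<close>
  have "\<exists>q\<in>R - {p}. \<exists>r\<in>R - {p}. f q \<noteq> f r"
  proof (rule ccontr)
    assume "\<not> ?thesis"
    then have eq: "f q2 = f q1" "f q3 = f q1" using qR by blast+
    let ?a = "f q1"
    have "card (C - {a0,?a}) = 2" using f[OF qR(1,4)] a0 C4 fin by (subst card_Diff_subset) auto
    then obtain b c where bc: "C - {a0,?a} = {b,c}" "b \<noteq> c" by (auto simp: card_2_iff)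
    then have d: "b \<in> C" "c \<in> C" "distinct [a0,?a,b,c]" using f[OF qR(1,4)] by auto
    have C: "C = {a0,?a,b,c}" by (rule four) (use d f[OF qR(1,4)] in auto)
    have or: "X q a0 * cnj (X r a0) + X q b * cnj (X r b) = 0"
      if "q \<in> {q1,q2,q3}" "r \<in> {q1,q2,q3}" "q \<noteq> r" for q r
    proof -
      have "f q = ?a" "f r = ?a" "q \<in> R" "q \<noteq> p" "r \<in> R" "r \<noteq> p" using that eq qR by auto
      then have "X q ?a = - X q a0" "X r ?a = - X r a0" "X q c = - X q b" "X r c = - X r b"
        using f(3)[of q] f(3)[of r] f4[of q b c] f4[of r b c] d by auto
      moreover have "X q a0 * cnj (X r a0) + X q ?a * cnj (X r ?a) + X q b * cnj (X r b) + X q c * cnj (X r c)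
         = (\<Sum>i\<in>C. X q i * cnj (X r i))"
        using d by (subst C) (simp add: add_ac)
      moreover have "\<dots> = 0" using that qR by (intro oX) auto
      ultimately have "2 * (X q a0 * cnj (X r a0) + X q b * cnj (X r b)) = 0"
        by (simp add: algebra_simps)
      then show ?thesis unfolding mult_eq_0_iff by simp
    qed
    have u: "X q i * cnj (X q i) = 1" if "q \<in> R" "i \<in> C" for q i using nX[OF that] by (rule unit_mult_cnj)
    have "X q2 a0 * cnj (X q3 a0) = 0"
    proof -
      have o: "X q2 a0 * cnj (X q1 a0) + X q2 b * cnj (X q1 b) = 0"
        "X q1 a0 * cnj (X q3 a0) + X q1 b * cnj (X q3 b) = 0"
        "X q2 a0 * cnj (X q3 a0) + X q2 b * cnj (X q3 b) = 0"
        using or[of q2 q1] or[of q1 q3] or[of q2 q3] q(2-4) by auto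
      note v = u[OF qR(1) a0] u[OF qR(1) d(1)]
      have "X q2 b = - X q2 a0 * cnj (X q1 a0) * X q1 b" using o(1) v by algebra
      moreover have "cnj (X q3 b) = - X q1 a0 * cnj (X q3 a0) * cnj (X q1 b)" using o(2) v by algebra
      ultimately have "X q2 b * cnj (X q3 b) =
          X q2 a0 * cnj (X q3 a0) * (X q1 a0 * cnj (X q1 a0)) * (X q1 b * cnj (X q1 b))"
        by simp
      then have "X q2 b * cnj (X q3 b) = X q2 a0 * cnj (X q3 a0)" unfolding v by simp
      then show ?thesis using o(3) by simp
    qed
    then show False using nX[OF qR(2) a0] nX[OF qR(3) a0] by auto
  qed
  then obtain q r where qr: "q \<in> R" "r \<in> R" "q \<noteq> p" "r \<noteq> p" "f q \<noteq> f r" by blast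
  let ?a = "f q" and ?b = "f r"
  have fq: "f q \<in> C" "f q \<noteq> a0" "X q (f q) = - X q a0" using f[OF qr(1,3)] by auto
  have fr: "f r \<in> C" "f r \<noteq> a0" "X r (f r) = - X r a0" using f[OF qr(2,4)] by auto
  have "card (C - {a0,?a,?b}) = 1" using fq fr qr a0 C4 fin by (subst card_Diff_subset) auto
  then obtain c where c: "C - {a0,?a,?b} = {c}" by (auto simp: card_1_singleton_iff)
  then have c': "c \<in> C" "c \<noteq> a0" "c \<noteq> ?a" "c \<noteq> ?b" by auto
  have C: "C = {a0,?a,?b,c}" by (rule four) (use c' fq fr qr in auto)
  have qc: "X q c = - X q ?b" using fq fr c' qr(5) by (intro f4[OF qr(1,3)]) auto
  have rc: "X r c = - X r ?a" using fq fr c' qr(5) by (intro f4[OF qr(2,4)]) auto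
  have "X q a0 * cnj (X r a0) + X q ?a * cnj (X r ?a) + X q ?b * cnj (X r ?b) + X q c * cnj (X r c)
         = (\<Sum>i\<in>C. X q i * cnj (X r i))"
    using c' fq fr qr(5) by (subst C) (simp add: add_ac)
  also have "\<dots> = 0" using qr by (intro oX) auto
  finally have "(X q a0 - X q ?b) * (cnj (X r a0) - cnj (X r ?a)) = 0"
    unfolding fq(3) fr(3) qc rc by (simp add: algebra_simps)
  then consider "X q ?b = X q a0" | "X r ?a = X r a0" by auto
  then show ?thesis
  proof cases
    case 1
    have "C = {a0,?a,?b,c} \<and> distinct [a0,?a,?b,c] \<and> X q ?a = - X q a0 \<and> X q ?b = X q a0 \<and>
      X q c = - X q a0 \<and> X r ?b = - X r a0 \<and> X r c = - X r ?a"
      using C c' fq fr qr(5) 1 qc rc by auto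
    then show ?thesis using p qr(1,2) unfolding X_def by blast
  next
    case 2
    have "C = {a0,?b,?a,c} \<and> distinct [a0,?b,?a,c] \<and> X r ?b = - X r a0 \<and> X r ?a = X r a0 \<and>
      X r c = - X r a0 \<and> X q ?a = - X q a0 \<and> X q c = - X q ?b"
      using C c' fq fr qr(5) 2 qc rc by auto
    then show ?thesis using p qr(1,2) unfolding X_def by blast
  qed
qed

section \<open>Tilings of the integer lattice\<close>

definition real_vec :: "int^'n \<Rightarrow> real^'n" where
  "real_vec t = (\<chi> i. of_int (t $ i))"

lemma real_vec_diff: "real_vec (s - t) = real_vec s - real_vec t"
  by (simp add: real_vec_def vec_eq_iff)

lemma cube_union_iff_floor: "x \<in> cube_union A \<longleftrightarrow> (\<chi> i. \<lfloor>x $ i\<rfloor>) \<in> A"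
proof -
  have "(\<forall>i. of_int (a $ i) \<le> x $ i \<and> x $ i < of_int (a $ i) + 1) \<longleftrightarrow> (\<chi> i. \<lfloor>x $ i\<rfloor>) = a" for a
    by (simp add: vec_eq_iff floor_eq_iff)
  then show ?thesis by (simp add: cube_union_def)
qed

text \<open>Integer translations commute with taking the cell of a point, so a tiling of the lattice
  carries over to every real point, with no exceptional null set.\<close>

lemma tiles_cube_unionI:
  fixes A T :: "(int^'n) set"
  assumes T: "\<And>x. \<exists>!a. a \<in> A \<and> x - a \<in> T"
  shows "tiles (cube_union A)"
proof -
  have "(\<Sum>\<^sub>\<infinity>t\<in>real_vec ` T. indicator (cube_union A) (x - t) :: real) = 1" for x :: "real^'n"
  proof -
    define k :: "int^'n" where "k = (\<chi> i. \<lfloor>x $ i\<rfloor>)"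
    have ind: "indicator (cube_union A) (x - real_vec t) = (of_bool (k - t \<in> A) :: real)" for t
    proof -
      have "(\<chi> i. \<lfloor>(x - real_vec t) $ i\<rfloor>) = k - t"
        by (simp add: k_def real_vec_def vec_eq_iff)
      then show ?thesis by (simp add: cube_union_iff_floor indicator_def)
    qed
    obtain a where a: "a \<in> A" "k - a \<in> T" and un: "\<And>b. b \<in> A \<Longrightarrow> k - b \<in> T \<Longrightarrow> b = a"
      using T[of k] by blast
    have "(\<Sum>\<^sub>\<infinity>t\<in>real_vec ` T. indicator (cube_union A) (x - t) :: real) =
        (\<Sum>\<^sub>\<infinity>t\<in>{real_vec (k - a)}. indicator (cube_union A) (x - t))"
    proof (rule infsum_cong_neutral)
      fix t assume "t \<in> real_vec ` T - {real_vec (k - a)}"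
      then obtain s where s: "t = real_vec s" "s \<in> T" "s \<noteq> k - a" by auto
      then have "k - s \<notin> A" using un[of "k - s"] by auto
      then show "indicator (cube_union A) (x - t) = (0::real)" by (simp add: s ind)
    qed (use a in auto)
    also have "\<dots> = 1" using a by (simp add: ind)
    finally show ?thesis .
  qed
  then show ?thesis unfolding tiles_def by blast
qed

lemma cis_2pi_eq_iff: "cis (2 * pi * s) = cis (2 * pi * t) \<longleftrightarrow> s - t \<in> \<int>"
proof -
  have "cis (2 * pi * s) = cis (2 * pi * t) \<longleftrightarrow> cis (2 * pi * (s - t)) = 1"
    by (simp add: cis_divide[symmetric] right_diff_distrib)
  also have "\<dots> \<longleftrightarrow> (\<exists>n::int. 2 * pi * (s - t) = of_int (2 * n) * pi)"
    by (simp add: cis_conv_exp exp_eq_1)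
  also have "\<dots> \<longleftrightarrow> (\<exists>n::int. s - t = of_int n)"
  proof -
    have "2 * pi * (s - t) = of_int (2 * n) * pi \<longleftrightarrow> s - t = of_int n" for n :: int
    proof -
      have "of_int (2 * n) * pi = 2 * pi * of_int n" by simp
      then show ?thesis by (simp only: mult_cancel_left) simp
    qed
    then show ?thesis by blast
  qed
  also have "\<dots> \<longleftrightarrow> s - t \<in> \<int>" by (auto simp: Ints_def)
  finally show ?thesis .
qed

text \<open>The function \<open>\<phi>\<close> is additive with real values. On A it is integral up
  to the constant \<open>\<phi> a0\<close> because the powers agree, and its residues modulo N
  exhaust {0..<N} because the values of \<open>cis\<close> are distinct. Passing from x to x - a
  therefore moves the floor of \<open>\<phi> x - \<phi> a0\<close> by the integer
  \<open>n a\<close>, and exactly one a makes the result divisible by N.\<close>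

lemma tiles_if_roots_of_unity:
  fixes A :: "(int^'n) set" and u :: "real^'n"
  assumes fin: "finite A" and ne: "A \<noteq> {}"
    and inj: "inj_on (\<lambda>a. cis (2 * pi * (u \<bullet> real_vec a))) A"
    and pow: "\<And>a b. a \<in> A \<Longrightarrow> b \<in> A \<Longrightarrow>
      cis (2 * pi * (u \<bullet> real_vec a)) ^ card A = cis (2 * pi * (u \<bullet> real_vec b)) ^ card A"
  shows "tiles (cube_union A)"
proof -
  define N where "N = int (card A)"
  have N: "N > 0" using fin ne by (simp add: N_def card_gt_0_iff)
  define \<phi> where "\<phi> a = of_int N * (u \<bullet> real_vec a)" for a
  have \<phi>_diff: "\<phi> (a - b) = \<phi> a - \<phi> b" for a b
    by (simp add: \<phi>_def real_vec_diff inner_diff_right right_diff_distrib)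
  obtain a0 where a0: "a0 \<in> A" using ne by blast
  have "\<phi> a - \<phi> a0 \<in> \<int>" if "a \<in> A" for a
  proof -
    have "cis (2 * pi * \<phi> c) = cis (2 * pi * (u \<bullet> real_vec c)) ^ card A" for c
      by (simp add: Complex.DeMoivre \<phi>_def N_def mult_ac)
    then have "cis (2 * pi * \<phi> a) = cis (2 * pi * \<phi> a0)"
      using pow[OF that a0] by simp
    then show ?thesis by (simp add: cis_2pi_eq_iff)
  qed
  then have "\<forall>a\<in>A. \<exists>n::int. \<phi> a = \<phi> a0 + of_int n" by (force simp: Ints_def algebra_simps)
  then obtain n :: "int^'n \<Rightarrow> int" where n: "\<And>a. a \<in> A \<Longrightarrow> \<phi> a = \<phi> a0 + of_int (n a)" by metis
  have "inj_on (\<lambda>a. n a mod N) A"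
  proof (rule inj_onI)
    fix a b assume ab: "a \<in> A" "b \<in> A" "n a mod N = n b mod N"
    then obtain m where "n a - n b = N * m" by (auto simp: mod_eq_dvd_iff)
    then have "real_of_int (n a) - of_int (n b) = of_int N * of_int m"
      by (metis of_int_diff of_int_mult)
    then have "\<phi> a - \<phi> b = of_int N * of_int m" using n ab by simp
    then have "u \<bullet> real_vec a - u \<bullet> real_vec b = of_int m"
      using N by (simp add: \<phi>_def right_diff_distrib[symmetric])
    then have "cis (2 * pi * (u \<bullet> real_vec a)) = cis (2 * pi * (u \<bullet> real_vec b))"
      by (simp add: cis_2pi_eq_iff)
    then show "a = b" using inj ab by (auto dest: inj_onD)
  qed
  moreover have "(\<lambda>a. n a mod N) ` A \<subseteq> {0..<N}" using N by auto
  ultimately have bij: "bij_betw (\<lambda>a. n a mod N) A {0..<N}"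
    by (intro bij_betw_imageI card_subset_eq) (auto simp: card_image N_def)
  show ?thesis
  proof (rule tiles_cube_unionI[where T = "{x. N dvd \<lfloor>\<phi> x\<rfloor>}"])
    fix x
    have "N dvd \<lfloor>\<phi> (x - a)\<rfloor> \<longleftrightarrow> n a mod N = \<lfloor>\<phi> x - \<phi> a0\<rfloor> mod N" if "a \<in> A" for a
    proof -
      have "\<lfloor>\<phi> (x - a)\<rfloor> = \<lfloor>\<phi> x - \<phi> a0\<rfloor> - n a"
        using n[OF that] by (simp add: \<phi>_diff diff_diff_eq[symmetric])
      then show ?thesis by (metis mod_eq_dvd_iff)
    qed
    moreover have "\<exists>!a. a \<in> A \<and> n a mod N = \<lfloor>\<phi> x - \<phi> a0\<rfloor> mod N"
    proof -
      have "\<lfloor>\<phi> x - \<phi> a0\<rfloor> mod N \<in> (\<lambda>a. n a mod N) ` A"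
        using N by (simp add: bij_betw_imp_surj_on[OF bij])
      then obtain a where "a \<in> A" "\<lfloor>\<phi> x - \<phi> a0\<rfloor> mod N = n a mod N" by blast
      moreover have "b = a" if "b \<in> A" "n b mod N = n a mod N" for b
        using inj_onD[OF bij_betw_imp_inj_on[OF bij] that(2,1)] \<open>a \<in> A\<close> by simp
      ultimately show ?thesis by (intro ex1I[of _ a]) auto
    qed
    ultimately show "\<exists>!a. a \<in> A \<and> x - a \<in> {x. N dvd \<lfloor>\<phi> x\<rfloor>}" by auto
  qed
qed

text \<open>Opposite values of \<open>e w\<close> mean that twice the inner product changes by an
  odd integer, which flips the parity of \<open>h w\<close>. The parity for u selects {a0, a2} or
  {a1, a3}, and the parity for v selects one point of that pair; values of v on different pairs are
  never compared.\<close>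

lemma tiles_if_sign_rows:
  fixes A :: "(int^'n) set" and u v :: "real^'n"
  defines "e \<equiv> \<lambda>u a. cis (2 * pi * (u \<bullet> real_vec a))"
  assumes A: "A = {a0,a1,a2,a3}" "distinct [a0,a1,a2,a3]"
    and u: "e u a1 = - e u a0" "e u a2 = e u a0" "e u a3 = - e u a0"
    and v: "e v a2 = - e v a0" "e v a3 = - e v a1"
  shows "tiles (cube_union A)"
proof -
  define h where "h u x = \<lfloor>2 * (u \<bullet> real_vec x)\<rfloor>" for u and x :: "int^'n"
  have half: "\<exists>n::int. 2 * (w \<bullet> real_vec b) = 2 * (w \<bullet> real_vec a) + of_int (2 * n + 1)"
    if "e w b = - e w a" for w a b
  proof -
    have "- e w a = cis (2 * pi * (w \<bullet> real_vec a + 1/2))"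
      by (simp add: e_def distrib_left cis_mult[symmetric])
    then have "w \<bullet> real_vec b - (w \<bullet> real_vec a + 1/2) \<in> \<int>"
      using that by (simp only: e_def cis_2pi_eq_iff)
    then obtain n :: int where "w \<bullet> real_vec b - (w \<bullet> real_vec a + 1/2) = of_int n" by (auto simp: Ints_def)
    then have "2 * (w \<bullet> real_vec b) = 2 * (w \<bullet> real_vec a) + of_int (2 * n + 1)" by simp
    then show ?thesis ..
  qed
  have flip: "even (h w (x - b)) \<longleftrightarrow> odd (h w (x - a))" if eq: "e w b = - e w a" for w a b x
  proof -
    obtain n :: int where n: "2 * (w \<bullet> real_vec b) = 2 * (w \<bullet> real_vec a) + of_int (2 * n + 1)"
      using half[OF eq] by blast
    have "h w (x - b) = \<lfloor>2 * (w \<bullet> real_vec (x - a)) - of_int (2 * n + 1)\<rfloor>"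
      using n by (simp add: h_def real_vec_diff inner_diff_right right_diff_distrib diff_diff_eq)
    also have "\<dots> = h w (x - a) - (2 * n + 1)" unfolding h_def by (rule floor_diff_of_int)
    finally show ?thesis by simp
  qed
  show ?thesis
  proof (rule tiles_cube_unionI[where T = "{x. even (h u x) \<and> even (h v x)}"])
    fix x
    have "even (h u (x - a1)) \<longleftrightarrow> odd (h u (x - a0))" "even (h u (x - a3)) \<longleftrightarrow> odd (h u (x - a0))"
      "even (h u (x - a1)) \<longleftrightarrow> odd (h u (x - a2))"
      "even (h v (x - a2)) \<longleftrightarrow> odd (h v (x - a0))" "even (h v (x - a3)) \<longleftrightarrow> odd (h v (x - a1))"
      using u v by (auto intro!: flip)
    then consider
        "even (h u (x - a0))" "even (h v (x - a0))" "odd (h u (x - a1))" "odd (h v (x - a2))" "odd (h u (x - a3))"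
      | "even (h u (x - a0))" "odd (h v (x - a0))" "odd (h u (x - a1))" "even (h u (x - a2))" "even (h v (x - a2))" "odd (h u (x - a3))"
      | "odd (h u (x - a0))" "even (h u (x - a1))" "even (h v (x - a1))" "odd (h u (x - a2))" "odd (h v (x - a3))"
      | "odd (h u (x - a0))" "odd (h v (x - a1))" "odd (h u (x - a2))" "even (h u (x - a3))" "even (h v (x - a3))"
      by metis
    then show "\<exists>!a. a \<in> A \<and> x - a \<in> {x. even (h u x) \<and> even (h v x)}"
    proof cases
      case 1 then show ?thesis using A by (intro ex1I[of _ a0]) auto
    next
      case 2 then show ?thesis using A by (intro ex1I[of _ a2]) auto
    next
      case 3 then show ?thesis using A by (intro ex1I[of _ a1]) auto
    next
      case 4 then show ?thesis using A by (intro ex1I[of _ a3]) auto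
    qed
  qed
qed

lemma tiles_if_lattice_spectrum:
  fixes A :: "(int^'n) set" and L :: "(real^'n) set"
  assumes A: "finite A" "A \<noteq> {}" "card A \<le> 5" and L: "finite L" "card L = card A"
    and orth: "\<And>l m. l \<in> L \<Longrightarrow> m \<in> L \<Longrightarrow> l \<noteq> m \<Longrightarrow>
      (\<Sum>a\<in>A. cis (2 * pi * ((l - m) \<bullet> real_vec a))) = 0"
  shows "tiles (cube_union A)"
proof -
  define W :: "real^'n \<Rightarrow> int^'n \<Rightarrow> complex"
    where "W = (\<lambda>l a. cis (2 * pi * (l \<bullet> real_vec a)))"
  have W: "W q a * cnj (W p a) = cis (2 * pi * ((q - p) \<bullet> real_vec a))" for p q :: "real^'n" and a
    by (simp add: W_def cis_cnj cis_mult inner_diff_left right_diff_distrib)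
  have H: "complex_hadamard L A W"
    using A L orth unfolding complex_hadamard_def W by (simp add: W_def)
  have pos: "card A > 0" using A by (simp add: card_gt_0_iff)
  have roots: "tiles (cube_union A)"
    if "\<exists>p\<in>L. \<exists>q\<in>L. inj_on (\<lambda>i. W q i * cnj (W p i)) A \<and>
    (\<forall>i\<in>A. \<forall>j\<in>A. (W q i * cnj (W p i)) ^ card A = (W q j * cnj (W p j)) ^ card A)"
  proof -
    from that obtain p q where "inj_on (\<lambda>i. W q i * cnj (W p i)) A"
      "\<forall>i\<in>A. \<forall>j\<in>A. (W q i * cnj (W p i)) ^ card A = (W q j * cnj (W p j)) ^ card A" by blast
    note pq = this[unfolded W]
    show ?thesis by (rule tiles_if_roots_of_unity[OF A(1,2) pq(1)]) (use pq(2) in blast)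
  qed
  consider "card A = 1" | "card A = 2 \<or> card A = 3" | "card A = 4" | "card A = 5" using A(3) pos by linarith
  then show ?thesis
  proof cases
    case 1
    then obtain a where "A = {a}" by (auto simp: card_1_singleton_iff)
    then show ?thesis using A by (intro tiles_if_roots_of_unity[where u = 0]) simp_all
  next
    case 2
    then show ?thesis by (intro roots hadamard_order_2_3_powers[OF H])
  next
    case 3
    from hadamard4_sign_rows[OF H 3] show ?thesis
      unfolding W by (elim bexE exE conjE) (rule tiles_if_sign_rows; assumption)
  next
    case 4
    from hadamard5_fifth_powers[OF H 4] show ?thesis unfolding 4[symmetric] by (rule roots)
  qed
qed

section \<open>Parseval identity for complete orthogonal systems\<close>

lemma borel_measurable_cnj [measurable (raw)]:
  "f \<in> borel_measurable M \<Longrightarrow> (\<lambda>x. cnj (f x)) \<in> borel_measurable M"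
  by (rule measurable_compose[OF _ borel_measurable_continuous_onI])
    (auto intro!: continuous_intros)

lemma integral_norm_sum_sq:
  fixes e :: "'i \<Rightarrow> 'a \<Rightarrow> complex"
  assumes M: "finite_measure M" and F: "finite F"
    and meas: "\<And>i. i \<in> F \<Longrightarrow> e i \<in> borel_measurable M"
    and unit: "\<And>i x. i \<in> F \<Longrightarrow> norm (e i x) = 1"
    and orth: "\<And>i j. i \<in> F \<Longrightarrow> j \<in> F \<Longrightarrow> i \<noteq> j \<Longrightarrow> (LINT x|M. e i x * cnj (e j x)) = 0"
  shows "(LINT x|M. (norm (\<Sum>i\<in>F. c i * e i x))\<^sup>2) = measure M (space M) * (\<Sum>i\<in>F. (norm (c i))\<^sup>2)"
proof -
  interpret finite_measure M by (rule M)
  have int: "integrable M (\<lambda>x. e i x * cnj (e j x))" if "i \<in> F" "j \<in> F" for i j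
    by (rule integrable_const_bound[where B = 1]) (use that meas unit in \<open>auto simp: norm_mult intro!: borel_measurable_times borel_measurable_cnj\<close>)
  have ip: "(LINT x|M. e i x * cnj (e j x)) = (if j = i then of_real (measure M (space M)) else 0)"
    if "i \<in> F" "j \<in> F" for i j
  proof (cases "j = i")
    case True
    then have "e i x * cnj (e j x) = 1" for x using unit that by (simp add: complex_norm_square[symmetric])
    then show ?thesis using True by (simp add: scaleR_conv_of_real)
  qed (use orth that in auto)
  have "complex_of_real (LINT x|M. (norm (\<Sum>i\<in>F. c i * e i x))\<^sup>2)
      = (LINT x|M. complex_of_real ((norm (\<Sum>i\<in>F. c i * e i x))\<^sup>2))"
    by (rule integral_complex_of_real[symmetric])
  also have "\<dots> = (LINT x|M. (\<Sum>i\<in>F. \<Sum>j\<in>F. (c i * cnj (c j)) * (e i x * cnj (e j x))))"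
    by (intro Bochner_Integration.integral_cong refl)
      (simp add: complex_norm_square sum_product mult_ac del: of_real_power)
  also have "\<dots> = (\<Sum>i\<in>F. \<Sum>j\<in>F. (c i * cnj (c j)) * (LINT x|M. e i x * cnj (e j x)))"
    using int by (simp add: Bochner_Integration.integral_sum)
  also have "\<dots> = (\<Sum>i\<in>F. \<Sum>j\<in>F. if j = i then c i * cnj (c i) * of_real (measure M (space M)) else 0)"
    by (intro sum.cong refl) (simp add: ip)
  also have "\<dots> = complex_of_real (measure M (space M) * (\<Sum>i\<in>F. (norm (c i))\<^sup>2))"
    using F by (simp add: complex_norm_square sum_distrib_left mult_ac del: of_real_power)
  finally show ?thesis by (simp only: of_real_eq_iff)
qed

text \<open>Each \<open>e i\<close> has squared norm m, the total measure, so the projection s has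
  coefficients p i / m. The estimate is the nonnegativity of the squared distance between f and s.
  Boundedness of f on a finite measure supplies integrability.\<close>

lemma bessel_inequality:
  fixes e :: "'i \<Rightarrow> 'a \<Rightarrow> complex"
  assumes M: "finite_measure M" and F: "finite F"
    and meas: "\<And>i. i \<in> F \<Longrightarrow> e i \<in> borel_measurable M"
    and unit: "\<And>i x. i \<in> F \<Longrightarrow> norm (e i x) = 1"
    and orth: "\<And>i j. i \<in> F \<Longrightarrow> j \<in> F \<Longrightarrow> i \<noteq> j \<Longrightarrow> (LINT x|M. e i x * cnj (e j x)) = 0"
    and f: "f \<in> borel_measurable M" and bd: "\<And>x. norm (f x) \<le> B"
    and pos: "measure M (space M) > 0"
  shows "(\<Sum>i\<in>F. (norm (LINT x|M. f x * cnj (e i x)))\<^sup>2) \<le>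
    measure M (space M) * (LINT x|M. (norm (f x))\<^sup>2)"
proof -
  interpret finite_measure M by (rule M)
  define m where "m = measure M (space M)"
  define p where "p i = (LINT x|M. f x * cnj (e i x))" for i
  define c where "c i = p i / of_real m" for i
  define s where "s x = (\<Sum>i\<in>F. c i * e i x)" for x
  have B0: "B \<ge> 0" using bd[of undefined] by (rule order_trans[OF norm_ge_zero])
  have sm: "s \<in> borel_measurable M" unfolding s_def using meas by measurable
  have sb: "norm (s x) \<le> (\<Sum>i\<in>F. norm (c i))" for x
    unfolding s_def by (rule order_trans[OF norm_sum]) (simp add: norm_mult unit)
  have int1: "integrable M (\<lambda>x. f x * cnj (e i x))" if "i \<in> F" for i
    by (rule integrable_const_bound[where B = B]) (use that meas unit f bd in \<open>auto simp: norm_mult intro!: borel_measurable_times borel_measurable_cnj\<close>)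
  have fs_eq: "f x * cnj (s x) = (\<Sum>i\<in>F. cnj (c i) * (f x * cnj (e i x)))" for x
    by (simp add: s_def sum_distrib_left mult_ac)
  have intfs: "integrable M (\<lambda>x. f x * cnj (s x))"
    unfolding fs_eq using int1 by (intro Bochner_Integration.integrable_sum) simp
  have intf: "integrable M (\<lambda>x. (norm (f x))\<^sup>2)"
    by (rule integrable_const_bound[where B = "B\<^sup>2"]) (use f bd in \<open>auto intro!: power_mono\<close>)
  have ints: "integrable M (\<lambda>x. (norm (s x))\<^sup>2)"
    by (rule integrable_const_bound[where B = "(\<Sum>i\<in>F. norm (c i))\<^sup>2"])
      (use sm sb in \<open>auto intro!: power_mono\<close>)
  have "(LINT x|M. f x * cnj (s x)) = (\<Sum>i\<in>F. cnj (c i) * p i)"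
    unfolding fs_eq p_def using int1 by (simp add: Bochner_Integration.integral_sum)
  also have "\<dots> = of_real (m * (\<Sum>i\<in>F. (norm (c i))\<^sup>2))"
  proof -
    have "p i = of_real m * c i" for i using pos by (simp add: c_def m_def)
    then have "cnj (c i) * p i = of_real (m * (norm (c i))\<^sup>2)" for i
      unfolding of_real_mult complex_norm_square by (simp add: mult_ac)
    then show ?thesis by (simp add: sum_distrib_left)
  qed
  finally have fs: "(LINT x|M. f x * cnj (s x)) = of_real (m * (\<Sum>i\<in>F. (norm (c i))\<^sup>2))" .
  have "(norm (f x - s x))\<^sup>2 = (norm (f x))\<^sup>2 - 2 * Re (f x * cnj (s x)) + (norm (s x))\<^sup>2" for x
    unfolding cmod_power2 by (simp add: power2_eq_square algebra_simps)
  then have "(LINT x|M. (norm (f x - s x))\<^sup>2) =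
      (LINT x|M. (norm (f x))\<^sup>2) - 2 * Re (LINT x|M. f x * cnj (s x)) + (LINT x|M. (norm (s x))\<^sup>2)"
    using intf ints intfs by (simp add: integral_Re del: times_complex.simps)
  also have "(LINT x|M. (norm (s x))\<^sup>2) = m * (\<Sum>i\<in>F. (norm (c i))\<^sup>2)"
    unfolding s_def m_def by (rule integral_norm_sum_sq[OF M F meas unit orth])
  finally have "(LINT x|M. (norm (f x - s x))\<^sup>2) = (LINT x|M. (norm (f x))\<^sup>2) - m * (\<Sum>i\<in>F. (norm (c i))\<^sup>2)"
    using fs by simp
  moreover have "(LINT x|M. (norm (f x - s x))\<^sup>2) \<ge> 0" by simp
  ultimately have "m * (m * (\<Sum>i\<in>F. (norm (c i))\<^sup>2)) \<le> m * (LINT x|M. (norm (f x))\<^sup>2)"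
    using pos by (intro mult_left_mono) (auto simp: m_def)
  moreover have "m * (m * (norm (c i))\<^sup>2) = (norm (p i))\<^sup>2" for i
    using pos by (simp add: c_def m_def norm_divide power_divide power2_eq_square)
  ultimately show ?thesis by (simp add: sum_distrib_left p_def m_def)
qed

lemma AE_summable_norm_if_integrals_summable:
  fixes u :: "nat \<Rightarrow> 'a \<Rightarrow> complex"
  assumes int: "\<And>k. integrable M (u k)" and sum: "summable (\<lambda>k. LINT x|M. norm (u k x))"
  shows "AE x in M. summable (\<lambda>k. norm (u k x))"
proof -
  have [measurable]: "u k \<in> borel_measurable M" for k using int by auto
  have "(\<integral>\<^sup>+x. (\<Sum>k. ennreal (norm (u k x))) \<partial>M) = (\<Sum>k. \<integral>\<^sup>+x. norm (u k x) \<partial>M)"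
    by (intro nn_integral_suminf) auto
  also have "\<dots> = (\<Sum>k. ennreal (LINT x|M. norm (u k x)))"
    by (intro arg_cong[where f=suminf] ext nn_integral_eq_integral integrable_norm int) auto
  also have "\<dots> \<noteq> \<infinity>" by (simp add: sum ennreal_suminf_neq_top)
  finally have "AE x in M. (\<Sum>k. ennreal (norm (u k x))) \<noteq> \<infinity>"
    by (intro nn_integral_PInf_AE) auto
  then show ?thesis
    by eventually_elim (auto intro!: summable_suminf_not_top)
qed

text \<open>The conclusion is the half of Parseval beyond Bessel, phrased with finite sets so that
  an uncountable I raises no question of convergence. S is the supremum of the normalised finite
  sums. A series g with the coefficients of f is built from nearly optimal finite sets; completeness
  gives f = g almost everywhere, and Fatou bounds the squared norm of g by m * S.\<close>

lemma parseval_if_complete: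
  fixes e :: "'i \<Rightarrow> 'a \<Rightarrow> complex"
  assumes M: "finite_measure M" and pos: "measure M (space M) > 0"
    and meas: "\<And>i. i \<in> I \<Longrightarrow> e i \<in> borel_measurable M"
    and unit: "\<And>i x. i \<in> I \<Longrightarrow> norm (e i x) = 1"
    and orth: "\<And>i j. i \<in> I \<Longrightarrow> j \<in> I \<Longrightarrow> i \<noteq> j \<Longrightarrow> (LINT x|M. e i x * cnj (e j x)) = 0"
    and complete: "\<And>h. h \<in> borel_measurable M \<Longrightarrow> integrable M (\<lambda>x. (norm (h x))\<^sup>2) \<Longrightarrow>
      (\<And>i. i \<in> I \<Longrightarrow> (LINT x|M. h x * cnj (e i x)) = 0) \<Longrightarrow> AE x in M. h x = 0"
    and f: "f \<in> borel_measurable M" and bd: "\<And>x. norm (f x) \<le> B"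
    and \<delta>: "\<delta> > 0"
  shows "\<exists>F\<subseteq>I. finite F \<and> measure M (space M) * (LINT x|M. (norm (f x))\<^sup>2) - \<delta>
    \<le> (\<Sum>i\<in>F. (norm (LINT x|M. f x * cnj (e i x)))\<^sup>2)"
proof -
  interpret finite_measure M by (rule M)
  define m where "m = measure M (space M)"
  have m: "m > 0" using pos by (simp add: m_def)
  define p where "p i = (LINT x|M. f x * cnj (e i x))" for i
  define c where "c i = p i / of_real m" for i
  define K where "K F = (\<Sum>i\<in>F. (norm (c i))\<^sup>2)" for F
  define \<F> where "\<F> = {F. F \<subseteq> I \<and> finite F}"
  define S where "S = (SUP F\<in>\<F>. K F)"
  have pK: "(\<Sum>i\<in>F. (norm (p i))\<^sup>2) = m\<^sup>2 * K F" for F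
    using m by (simp add: K_def c_def norm_divide power_divide sum_divide_distrib[symmetric])
  have bdd: "bdd_above (K ` \<F>)"
  proof (rule bdd_aboveI2)
    fix F assume "F \<in> \<F>"
    then have "(\<Sum>i\<in>F. (norm (p i))\<^sup>2) \<le> m * (LINT x|M. (norm (f x))\<^sup>2)"
      unfolding p_def m_def by (intro bessel_inequality[OF M _ meas unit orth f bd pos]) (auto simp: \<F>_def)
    then have "m\<^sup>2 * K F \<le> m * (LINT x|M. (norm (f x))\<^sup>2)" unfolding pK .
    then show "K F \<le> (LINT x|M. (norm (f x))\<^sup>2) / m"
      using m by (simp add: field_simps power2_eq_square)
  qed
  have KS: "K F \<le> S" if "F \<in> \<F>" for F
    unfolding S_def using bdd that by (rule cSUP_upper2) simp
  have appr: "\<exists>F\<in>\<F>. S - \<eta> < K F" if "\<eta> > 0" for \<eta> :: real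
  proof -
    have "S - \<eta> < (SUP F\<in>\<F>. K F)" using that by (simp add: S_def)
    moreover have "\<F> \<noteq> {}" by (auto simp: \<F>_def)
    ultimately show ?thesis using less_cSUP_iff[of \<F> K "S - \<eta>"] bdd by blast
  qed
  \<comment> \<open>The gap 16^-k gives the block \<open>u (Suc k)\<close> a squared norm of at most
    m * 16^-k and hence an L1 norm of at most m * 4^-k, which is summable.\<close>
  have "\<forall>k::nat. \<exists>F. F \<in> \<F> \<and> S - (1/16)^k < K F" using appr by (meson zero_less_divide_1_iff zero_less_numeral zero_less_power)
  then obtain F where F: "\<And>k. F k \<in> \<F>" "\<And>k::nat. S - (1/16)^k < K (F k)" by metis
  define G where "G k = (\<Union>j\<le>k. F j)" for k :: nat
  have G: "G k \<in> \<F>" for k using F(1) by (auto simp: G_def \<F>_def)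
  have Gmono: "G k \<subseteq> G (Suc k)" for k unfolding G_def by (intro UN_mono) auto
  have Kmono: "K X \<le> K Y" if "X \<subseteq> Y" "Y \<in> \<F>" for X Y
    unfolding K_def using that by (intro sum_mono2) (auto simp: \<F>_def)
  have KG: "S - (1/16)^k < K (G k)" for k
    using F(2)[of k] Kmono[of "F k" "G k"] G[of k] by (fastforce simp: G_def)
  \<comment> \<open>A finite set disjoint from G k can add only what is still missing below
    S.\<close>
  have Kdisj: "K D \<le> (1/16)^k" if "D \<in> \<F>" "D \<inter> G k = {}" for D k
  proof -
    have "K (G k \<union> D) = K (G k) + K D"
      unfolding K_def using that G[of k] by (intro sum.union_disjoint) (auto simp: \<F>_def)
    moreover have "K (G k \<union> D) \<le> S" using that G[of k] by (intro KS) (auto simp: \<F>_def)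
    ultimately show ?thesis using KG[of k] by linarith
  qed
  \<comment> \<open>Disjoint blocks whose partial unions are the sets G n. \<open>Kdisj\<close>
    controls every block except the first, so the estimates below concern
    \<open>Suc k\<close>.\<close>
  define D where "D k = (case k of 0 \<Rightarrow> G 0 | Suc j \<Rightarrow> G (Suc j) - G j)" for k
  have D: "D k \<in> \<F>" for k using G by (auto simp: D_def \<F>_def split: nat.split)
  have DI: "D k \<subseteq> I" "finite (D k)" for k using D[of k] by (auto simp: \<F>_def)
  have sumD: "(\<Sum>k\<le>n. \<Sum>i\<in>D k. g i) = (\<Sum>i\<in>G n. g i)" for g :: "'i \<Rightarrow> complex" and n
  proof (induction n)
    case 0 then show ?case by (simp add: D_def)
  next
    case (Suc n)
    have "sum g (G (Suc n)) = sum g (G (Suc n) - G n) + sum g (G n)"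
      using Gmono G[of "Suc n"] by (intro sum.subset_diff) (auto simp: \<F>_def)
    then show ?case using Suc by (simp add: D_def add_ac)
  qed
  define u where "u k x = (\<Sum>i\<in>D k. c i * e i x)" for k x
  have um [measurable]: "u k \<in> borel_measurable M" for k
    unfolding u_def using meas DI by (intro borel_measurable_sum borel_measurable_times) auto
  have ub: "norm (u k x) \<le> (\<Sum>i\<in>D k. norm (c i))" for k x
  proof -
    have "norm (e i x) = 1" if "i \<in> D k" for i using that unit DI(1)[of k] by blast
    then show ?thesis unfolding u_def by (intro order_trans[OF norm_sum] sum_mono) (simp add: norm_mult)
  qed
  have uint: "integrable M (u k)" for k
    by (rule integrable_const_bound[OF _ um]) (use ub in auto)
  have u2int: "integrable M (\<lambda>x. (norm (u k x))\<^sup>2)" for k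
    by (rule integrable_const_bound[where B = "(\<Sum>i\<in>D k. norm (c i))\<^sup>2"])
      (use ub in \<open>auto intro!: power_mono\<close>)
  have uK: "(LINT x|M. (norm (u k x))\<^sup>2) = m * K (D k)" for k
    unfolding u_def m_def K_def
    by (rule integral_norm_sum_sq[OF M DI(2) meas unit orth]) (use DI in auto)
  \<comment> \<open>AM-GM with weight 4^k replaces the Cauchy-Schwarz inequality.\<close>
  have u1: "(LINT x|M. norm (u (Suc k) x)) \<le> m * (1/4)^k" for k
  proof -
    have "norm (u (Suc k) x) \<le> (4^k * (norm (u (Suc k) x))\<^sup>2 + (1/4)^k) / 2" for x
    proof -
      have "0 \<le> (2^k * norm (u (Suc k) x) - (1/2)^k)\<^sup>2" by simp
      also have "\<dots> = 4^k * (norm (u (Suc k) x))\<^sup>2 + (1/4)^k - 2 * norm (u (Suc k) x)"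
      proof -
        have "((2::real)^k)\<^sup>2 = (2\<^sup>2)^k" "((1/2::real)^k)\<^sup>2 = ((1/2)\<^sup>2)^k"
          by (simp_all only: power_mult[symmetric] mult.commute)
        then have a: "((2::real)^k)\<^sup>2 = 4^k" "((1/2::real)^k)\<^sup>2 = (1/4)^k" by (simp_all add: power2_eq_square)
        have "(2::real)^k * (1/2)^k = 1" by (simp add: power_mult_distrib[symmetric])
        then have "2 * (2^k * t) * (1/2)^k = 2 * t" for t :: real by (simp add: mult_ac)
        then show ?thesis by (simp only: power2_diff power_mult_distrib a)
      qed
      finally show ?thesis by simp
    qed
    then have "(LINT x|M. norm (u (Suc k) x)) \<le> (LINT x|M. (4^k * (norm (u (Suc k) x))\<^sup>2 + (1/4)^k) / 2)"
      using uint u2int by (intro integral_mono) auto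
    also have "\<dots> = (4^k * (m * K (D (Suc k))) + m * (1/4)^k) / 2"
      using u2int by (simp add: uK m_def)
    also have "\<dots> \<le> (4^k * (m * (1/16)^k) + m * (1/4)^k) / 2"
    proof -
      have "K (D (Suc k)) \<le> (1/16)^k" by (rule Kdisj[OF D]) (auto simp: D_def)
      then show ?thesis using m by (intro divide_right_mono add_right_mono mult_left_mono) auto
    qed
    also have "(4::real)^k * (m * (1/16)^k) = m * (1/4)^k"
      by (simp add: mult.left_commute power_mult_distrib[symmetric])
    finally show ?thesis by simp
  qed
  have usum: "summable (\<lambda>k. LINT x|M. norm (u k x))"
  proof (subst summable_Suc_iff[symmetric], rule summable_comparison_test')
    show "summable (\<lambda>k. m * (1/4)^k)" by (intro summable_mult summable_geometric) simp
    show "norm (LINT x|M. norm (u (Suc k) x)) \<le> m * (1/4)^k" for k using u1[of k] by simp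
  qed
  have uAE: "AE x in M. summable (\<lambda>k. norm (u k x))"
    by (rule AE_summable_norm_if_integrals_summable[OF uint usum])
  define g where "g x = (\<Sum>k. u k x)" for x
  have gm [measurable]: "g \<in> borel_measurable M"
    unfolding g_def by (rule borel_measurable_suminf) (rule um)
  have gcoef: "(LINT x|M. g x * cnj (e i x)) = p i" and gint: "integrable M (\<lambda>x. g x * cnj (e i x))"
    if i: "i \<in> I" for i
  proof -
    note [measurable] = meas[OF i]
    have nu: "norm (u k x * cnj (e i x)) = norm (u k x)" for k x by (simp add: norm_mult unit[OF i])
    have i1: "integrable M (\<lambda>x. u k x * cnj (e i x))" for k
      by (rule integrable_const_bound[where B = "\<Sum>i\<in>D k. norm (c i)"]) (use ub in \<open>auto simp: nu\<close>)
    have ng: "AE x in M. g x * cnj (e i x) = (\<Sum>k. u k x * cnj (e i x))"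
      using uAE by eventually_elim (auto simp: g_def intro!: suminf_mult2 summable_norm_cancel)
    have iS: "integrable M (\<lambda>x. \<Sum>k. u k x * cnj (e i x))"
      by (rule integrable_suminf[OF i1]) (use uAE usum in \<open>simp_all add: nu\<close>)
    then show "integrable M (\<lambda>x. g x * cnj (e i x))"
      by (rule integrable_cong_AE_imp) (use ng in auto)
    have "(\<lambda>k. LINT x|M. u k x * cnj (e i x)) sums (LINT x|M. (\<Sum>k. u k x * cnj (e i x)))"
      by (rule sums_integral[OF i1]) (use uAE usum in \<open>simp_all add: nu\<close>)
    moreover have "(LINT x|M. (\<Sum>k. u k x * cnj (e i x))) = (LINT x|M. g x * cnj (e i x))"
      using ng iS by (intro integral_cong_AE) auto
    moreover have "(LINT x|M. u k x * cnj (e i x)) = (\<Sum>j\<in>D k. if j = i then p i else 0)" for k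
    proof -
      have i2: "integrable M (\<lambda>x. e j x * cnj (e i x))" if "j \<in> I" for j
        by (rule integrable_const_bound[where B = 1])
          (use that i unit meas in \<open>auto simp: norm_mult intro!: borel_measurable_times borel_measurable_cnj\<close>)
      have "(LINT x|M. u k x * cnj (e i x)) = (LINT x|M. (\<Sum>j\<in>D k. c j * (e j x * cnj (e i x))))"
        unfolding u_def by (simp add: sum_distrib_right mult.assoc)
      also have "\<dots> = (\<Sum>j\<in>D k. c j * (LINT x|M. e j x * cnj (e i x)))"
        using i2 DI(1)[of k] by (subst Bochner_Integration.integral_sum) auto
      also have "\<dots> = (\<Sum>j\<in>D k. if j = i then p i else 0)"
      proof (intro sum.cong refl)
        fix j assume j: "j \<in> D k"
        show "c j * (LINT x|M. e j x * cnj (e i x)) = (if j = i then p i else 0)"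
        proof (cases "j = i")
          case True
          have "e i x * cnj (e i x) = 1" for x using unit[OF i] by (simp add: complex_norm_square[symmetric])
          then show ?thesis using True m by (simp add: c_def m_def[symmetric] scaleR_conv_of_real)
        next
          case False
          then show ?thesis using orth[of j i] i j DI by auto
        qed
      qed
      finally show ?thesis .
    qed
    ultimately have "(\<lambda>k. \<Sum>j\<in>D k. if j = i then p i else 0) sums (LINT x|M. g x * cnj (e i x))" by simp
    then have "(\<lambda>n. \<Sum>k\<le>n. \<Sum>j\<in>D k. if j = i then p i else 0) \<longlonglongrightarrow> (LINT x|M. g x * cnj (e i x))"
      by (simp add: sums_def_le)
    then have lim: "(\<lambda>n. if i \<in> G n then p i else 0) \<longlonglongrightarrow> (LINT x|M. g x * cnj (e i x))"
      unfolding sumD using G by (simp add: \<F>_def)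
    \<comment> \<open>An index with nonzero coefficient enters some G n, since otherwise its square
      alone would exceed the remaining gap. For all other indices the sequence is constantly
      0.\<close>
    have "p i = (LINT x|M. g x * cnj (e i x))"
    proof (cases "p i = 0")
      case True
      then show ?thesis using lim unfolding True if_cancel by (simp add: LIMSEQ_const_iff)
    next
      case False
      then have ci: "(norm (c i))\<^sup>2 > 0" using m by (simp add: c_def)
      obtain n0 where n0: "(1/16::real)^n0 < (norm (c i))\<^sup>2" using real_arch_pow_inv[OF ci, of "1/16"] by auto
      have "i \<in> G n0"
      proof (rule ccontr)
        assume "i \<notin> G n0"
        then have "K {i} \<le> (1/16)^n0" using i by (intro Kdisj) (auto simp: \<F>_def)
        then show False using n0 by (simp add: K_def)
      qed
      moreover have "G n0 \<subseteq> G n" if "n \<ge> n0" for n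
        unfolding G_def using that by (intro UN_mono) auto
      ultimately have "i \<in> G n" if "n \<ge> n0" for n using that by blast
      then have "(\<lambda>n. if i \<in> G n then p i else 0) \<longlonglongrightarrow> p i"
        by (intro tendsto_eventually) (auto simp: eventually_at_top_linorder)
      then show ?thesis using lim by (rule LIMSEQ_unique)
    qed
    then show "(LINT x|M. g x * cnj (e i x)) = p i" by simp
  qed
  have s2: "(\<integral>\<^sup>+x. ennreal ((norm (\<Sum>k\<le>n. u k x))\<^sup>2) \<partial>M) \<le> ennreal (m * S)" for n
  proof -
    have eq: "(\<Sum>k\<le>n. u k x) = (\<Sum>i\<in>G n. c i * e i x)" for x unfolding u_def by (rule sumD)
    have GI: "G n \<subseteq> I" "finite (G n)" using G[of n] by (auto simp: \<F>_def)
    have b: "norm (\<Sum>k\<le>n. u k x) \<le> (\<Sum>i\<in>G n. norm (c i))" for x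
    proof -
      have "norm (e i x) = 1" if "i \<in> G n" for i using that unit GI(1) by blast
      then show ?thesis unfolding eq by (intro order_trans[OF norm_sum] sum_mono) (simp add: norm_mult)
    qed
    have "integrable M (\<lambda>x. (norm (\<Sum>k\<le>n. u k x))\<^sup>2)"
      by (rule integrable_const_bound[where B = "(\<Sum>i\<in>G n. norm (c i))\<^sup>2"])
        (use b in \<open>auto intro!: power_mono\<close>)
    then have "(\<integral>\<^sup>+x. ennreal ((norm (\<Sum>k\<le>n. u k x))\<^sup>2) \<partial>M) = ennreal (LINT x|M. (norm (\<Sum>k\<le>n. u k x))\<^sup>2)"
      by (intro nn_integral_eq_integral) auto
    also have "(LINT x|M. (norm (\<Sum>k\<le>n. u k x))\<^sup>2) = m * K (G n)"
      unfolding eq m_def K_def by (rule integral_norm_sum_sq[OF M GI(2) meas unit orth]) (use GI in auto)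
    also have "ennreal (m * K (G n)) \<le> ennreal (m * S)"
      using m KS[OF G] by (intro ennreal_leI mult_left_mono) auto
    finally show ?thesis .
  qed
  have "(\<integral>\<^sup>+x. ennreal ((norm (g x))\<^sup>2) \<partial>M) = (\<integral>\<^sup>+x. liminf (\<lambda>n. ennreal ((norm (\<Sum>k\<le>n. u k x))\<^sup>2)) \<partial>M)"
  proof (rule nn_integral_cong_AE)
    show "AE x in M. ennreal ((norm (g x))\<^sup>2) = liminf (\<lambda>n. ennreal ((norm (\<Sum>k\<le>n. u k x))\<^sup>2))"
      using uAE
    proof eventually_elim
      case (elim x)
      then have "(\<lambda>k. u k x) sums g x" unfolding g_def by (rule summable_sums[OF summable_norm_cancel])
      then have "(\<lambda>n. \<Sum>k\<le>n. u k x) \<longlonglongrightarrow> g x" by (simp add: sums_def_le)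
      then have "(\<lambda>n. ennreal ((norm (\<Sum>k\<le>n. u k x))\<^sup>2)) \<longlonglongrightarrow> ennreal ((norm (g x))\<^sup>2)"
        by (intro tendsto_ennrealI tendsto_power tendsto_norm)
      then show ?case by (intro lim_imp_Liminf[symmetric]) auto
    qed
  qed
  also have "\<dots> \<le> liminf (\<lambda>n. \<integral>\<^sup>+x. ennreal ((norm (\<Sum>k\<le>n. u k x))\<^sup>2) \<partial>M)"
    by (rule nn_integral_liminf) measurable
  also have "\<dots> \<le> ennreal (m * S)"
  proof -
    have "liminf (\<lambda>n. \<integral>\<^sup>+x. ennreal ((norm (\<Sum>k\<le>n. u k x))\<^sup>2) \<partial>M) \<le> liminf (\<lambda>n::nat. ennreal (m * S))"
      by (rule Liminf_mono) (simp add: s2)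
    then show ?thesis by (simp add: Liminf_const)
  qed
  finally have gS: "(\<integral>\<^sup>+x. ennreal ((norm (g x))\<^sup>2) \<partial>M) \<le> ennreal (m * S)" .
  have g2int: "integrable M (\<lambda>x. (norm (g x))\<^sup>2)"
    by (rule integrableI_bounded) (use gS in \<open>auto intro: le_less_trans\<close>)
  have f2int: "integrable M (\<lambda>x. (norm (f x))\<^sup>2)"
    by (rule integrable_const_bound[where B = "B\<^sup>2"]) (use f bd in \<open>auto intro!: power_mono\<close>)
  have "AE x in M. f x - g x = 0"
  proof (rule complete)
    show "(\<lambda>x. f x - g x) \<in> borel_measurable M" using f by measurable
    have "integrable M (\<lambda>x. 2 * (norm (f x))\<^sup>2 + 2 * (norm (g x))\<^sup>2)" using f2int g2int by auto
    then show "integrable M (\<lambda>x. (norm (f x - g x))\<^sup>2)"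
    proof (rule Bochner_Integration.integrable_bound)
      have "(norm (f x - g x))\<^sup>2 \<le> 2 * (norm (f x))\<^sup>2 + 2 * (norm (g x))\<^sup>2" for x
      proof -
        have "(norm (f x - g x))\<^sup>2 \<le> (norm (f x) + norm (g x))\<^sup>2"
          by (intro power_mono norm_triangle_ineq4) auto
        also have "\<dots> \<le> 2 * (norm (f x))\<^sup>2 + 2 * (norm (g x))\<^sup>2"
          using sum_squares_bound[of "norm (f x)" "norm (g x)"] by (simp add: power2_sum)
        finally show ?thesis .
      qed
      then show "AE x in M. norm ((norm (f x - g x))\<^sup>2) \<le> norm (2 * (norm (f x))\<^sup>2 + 2 * (norm (g x))\<^sup>2)"
        by (auto simp: abs_of_nonneg)
    qed (use f in measurable)
    fix i assume i: "i \<in> I"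
    have "integrable M (\<lambda>x. f x * cnj (e i x))"
      by (rule integrable_const_bound[where B = B])
        (use i meas unit f bd in \<open>auto simp: norm_mult intro!: borel_measurable_times borel_measurable_cnj\<close>)
    then show "(LINT x|M. (f x - g x) * cnj (e i x)) = 0"
      using gcoef[OF i] gint[OF i] by (simp add: left_diff_distrib p_def)
  qed
  then have "(LINT x|M. (norm (f x))\<^sup>2) = (LINT x|M. (norm (g x))\<^sup>2)"
    using f by (intro integral_cong_AE) auto
  also have "\<dots> \<le> m * S"
  proof -
    have S0: "S \<ge> 0" using KS[of "{}"] by (simp add: \<F>_def K_def)
    have "ennreal (LINT x|M. (norm (g x))\<^sup>2) \<le> ennreal (m * S)"
      using gS g2int by (subst nn_integral_eq_integral[symmetric]) auto
    then show ?thesis using S0 m by (subst (asm) ennreal_le_iff) auto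
  qed
  finally have fS: "(LINT x|M. (norm (f x))\<^sup>2) \<le> m * S" .
  have "\<delta> / m\<^sup>2 > 0" using \<delta> m by simp
  then obtain X where X: "X \<in> \<F>" "S - \<delta> / m\<^sup>2 < K X" using appr by blast
  have "m * (LINT x|M. (norm (f x))\<^sup>2) - \<delta> \<le> m * (m * S) - \<delta>"
    using fS m by simp
  also have "\<dots> = m\<^sup>2 * (S - \<delta> / m\<^sup>2)" using m by (simp add: field_simps power2_eq_square)
  also have "\<dots> \<le> m\<^sup>2 * K X" using X(2) by (intro mult_left_mono) auto
  also have "\<dots> = (\<Sum>i\<in>X. (norm (p i))\<^sup>2)" by (rule pK[symmetric])
  finally show ?thesis using X(1) unfolding m_def p_def \<F>_def by blast
qed

section \<open>Density of the spectrum\<close>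

text \<open>Telescopes 1/j^2 <= 1/(j - 1) - 1/j; the end term is kept for the induction.\<close>

lemma sum_inverse_squares_tail:
  fixes r :: nat
  assumes "r \<ge> 2"
  shows "(\<Sum>j\<in>{r..<r+n}. 1 / (real j)\<^sup>2) \<le> 1 / (real r - 1) - 1 / (real (r + n) - 1)"
proof (induction n)
  case (Suc n)
  have p: "real (r + n) - 1 > 0" using assms by simp
  have "1 / (real (r + n))\<^sup>2 \<le> 1 / (real (r + n) - 1) - 1 / real (r + n)"
  proof -
    define t where "t = real (r + n)"
    have "1 / t\<^sup>2 \<le> 1 / (t * (t - 1))"
      using p unfolding power2_eq_square t_def by (intro divide_left_mono mult_left_mono mult_pos_pos) auto
    also have "\<dots> = 1 / (t - 1) - 1 / t"
      using p by (simp add: t_def divide_simps)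
    finally show ?thesis by (simp add: t_def)
  qed
  then show ?case using Suc by simp
qed simp

lemma sum_inverse_squares_finite:
  fixes r :: nat
  assumes r: "r \<ge> 2" and X: "finite X" and ge: "\<And>j. j \<in> X \<Longrightarrow> j \<ge> r"
  shows "(\<Sum>j\<in>X. 1 / (real j)\<^sup>2) \<le> 1 / (real r - 1)"
proof -
  obtain n where n: "X \<subseteq> {..<n}" using X finite_nat_iff_bounded by blast
  have "X \<subseteq> {r..<r+n}" using n ge by fastforce
  then have "(\<Sum>j\<in>X. 1 / (real j)\<^sup>2) \<le> (\<Sum>j\<in>{r..<r+n}. 1 / (real j)\<^sup>2)" by (intro sum_mono2) auto
  also have "\<dots> \<le> 1 / (real r - 1) - 1 / (real (r + n) - 1)" by (rule sum_inverse_squares_tail[OF r])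
  also have "\<dots> \<le> 1 / (real r - 1)" using r by simp
  finally show ?thesis .
qed

text \<open>Replaces x by its cell at a small cost. Cells in the window from -r to r^2 + r get the
  bound 1 of \<open>q1\<close>, together r^2 + 2 * r. For cells beyond it all r^2 translates are at
  least r away, so the decay leaves on each side at most r^2 / (r - 1), which is at most 2 * r. The
  excess 6 * r is of lower order than r^2.\<close>

lemma lattice_sum_majorant:
  fixes q :: "real \<Rightarrow> real" and r :: nat
  assumes r: "r \<ge> 2" and q0: "\<And>t. q t \<ge> 0" and q2: "\<And>t. q t \<le> 1 / t\<^sup>2 \<or> t = 0"
    and q1: "\<And>M x. (\<Sum>n<M. q (x - real n)) \<le> 1"
  shows "\<exists>G :: int \<Rightarrow> real. (\<forall>k. G k \<ge> 0) \<and> (\<forall>x. (\<Sum>n<r\<^sup>2. q (x - real n)) \<le> G \<lfloor>x\<rfloor>) \<and>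
    (\<forall>X. finite X \<longrightarrow> sum G X \<le> (real r)\<^sup>2 + 6 * real r)"
proof -
  define M where "M = r\<^sup>2"
  \<comment> \<open>For a cell [k, k + 1) outside the window, \<open>a k\<close> is its distance to
    the last translate M - 1 and \<open>b k\<close> its distance to the first translate 0.\<close>
  define a where "a k = nat (k - int M + 1)" for k :: int
  define b where "b k = nat (- k - 1)" for k :: int
  define G where "G k = (if k \<ge> int M + int r then real M / (real (a k))\<^sup>2
    else if k < - int r then real M / (real (b k))\<^sup>2 else 1)" for k :: int
  have q2': "q t \<le> 1 / s\<^sup>2" if "s > 0" "s \<le> \<bar>t\<bar>" for s t :: real
  proof -
    have "q t \<le> 1 / t\<^sup>2" using q2[of t] that by auto
    also have "\<dots> \<le> 1 / s\<^sup>2"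
      using that by (intro divide_left_mono) (auto simp: abs_le_square_iff[symmetric])
    finally show ?thesis .
  qed
  have bound: "(\<Sum>n<M. q (x - real n)) \<le> real M / s\<^sup>2" if "s > 0" "\<And>n. n < M \<Longrightarrow> s \<le> \<bar>x - real n\<bar>" for s x
  proof -
    have "(\<Sum>n<M. q (x - real n)) \<le> (\<Sum>n<M. 1 / s\<^sup>2)" using that by (intro sum_mono q2') auto
    then show ?thesis by simp
  qed
  have maj: "(\<Sum>n<M. q (x - real n)) \<le> G \<lfloor>x\<rfloor>" for x
  proof -
    consider (A) "\<lfloor>x\<rfloor> \<ge> int M + int r" | (B) "\<lfloor>x\<rfloor> < - int r" | (C) "\<lfloor>x\<rfloor> < int M + int r" "\<lfloor>x\<rfloor> \<ge> - int r" by linarith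
    then show ?thesis
    proof cases
      case A
      have "(\<Sum>n<M. q (x - real n)) \<le> real M / (real (a \<lfloor>x\<rfloor>))\<^sup>2"
      proof (rule bound)
        show "real (a \<lfloor>x\<rfloor>) > 0" using A by (simp add: a_def)
        fix n assume "n < M"
        then have "real n \<le> real M - 1" by simp
        moreover have "real (a \<lfloor>x\<rfloor>) = of_int \<lfloor>x\<rfloor> - real M + 1" using A by (simp add: a_def)
        moreover have "of_int \<lfloor>x\<rfloor> \<le> x" by simp
        ultimately show "real (a \<lfloor>x\<rfloor>) \<le> \<bar>x - real n\<bar>" by linarith
      qed
      then show ?thesis using A by (simp add: G_def)
    next
      case B
      have "(\<Sum>n<M. q (x - real n)) \<le> real M / (real (b \<lfloor>x\<rfloor>))\<^sup>2"
      proof (rule bound)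
        show "real (b \<lfloor>x\<rfloor>) > 0" using B r by (simp add: b_def)
        fix n
        have "real (b \<lfloor>x\<rfloor>) = - of_int \<lfloor>x\<rfloor> - 1" using B by (simp add: b_def)
        moreover have "x < of_int \<lfloor>x\<rfloor> + 1" by simp
        ultimately show "real (b \<lfloor>x\<rfloor>) \<le> \<bar>x - real n\<bar>" by linarith
      qed
      then show ?thesis using B by (simp add: G_def)
    next
      case C
      then show ?thesis using q1[of x M] by (simp add: G_def)
    qed
  qed
  have tot: "sum G X \<le> (real r)\<^sup>2 + 6 * real r" if X: "finite X" for X
  proof -
    define X1 where "X1 = {k\<in>X. k \<ge> int M + int r}"
    define X2 where "X2 = {k\<in>X. k < - int r}"
    define X3 where "X3 = {k\<in>X. k < int M + int r \<and> k \<ge> - int r}"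
    have fin: "finite X1" "finite X2" "finite X3" using X by (auto simp: X1_def X2_def X3_def)
    have "X = X1 \<union> (X2 \<union> X3)" by (auto simp: X1_def X2_def X3_def)
    moreover have "X1 \<inter> (X2 \<union> X3) = {}" "X2 \<inter> X3 = {}" by (auto simp: X1_def X2_def X3_def)
    ultimately have split: "sum G X = sum G X1 + (sum G X2 + sum G X3)"
      using fin by (simp add: sum.union_disjoint)
    have G1: "G k = real M * (1 / (real (a k))\<^sup>2)" if "k \<in> X1" for k using that by (simp add: G_def X1_def)
    have G2: "G k = real M * (1 / (real (b k))\<^sup>2)" if "k \<in> X2" for k using that by (simp add: G_def X2_def)
    have "inj_on a X1" by (auto simp: inj_on_def a_def X1_def)
    then have "sum G X1 = real M * (\<Sum>j\<in>a ` X1. 1 / (real j)\<^sup>2)"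
      by (simp add: G1 sum.reindex sum_distrib_left)
    also have "\<dots> \<le> real M * (1 / (real r - 1))"
      using fin by (intro mult_left_mono sum_inverse_squares_finite[OF r]) (auto simp: a_def X1_def)
    finally have s1: "sum G X1 \<le> real M * (1 / (real r - 1))" .
    have "inj_on b X2" by (auto simp: inj_on_def b_def X2_def)
    then have "sum G X2 = real M * (\<Sum>j\<in>b ` X2. 1 / (real j)\<^sup>2)"
      by (simp add: G2 sum.reindex sum_distrib_left)
    also have "\<dots> \<le> real M * (1 / (real r - 1))"
      using fin by (intro mult_left_mono sum_inverse_squares_finite[OF r]) (auto simp: b_def X2_def)
    finally have s2: "sum G X2 \<le> real M * (1 / (real r - 1))" .
    have "sum G X3 = real (card X3)" by (simp add: G_def X3_def)
    also have "card X3 \<le> card {- int r..<int M + int r}"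
      by (intro card_mono) (auto simp: X3_def)
    also have "card {- int r..<int M + int r} = M + 2 * r" by simp
    finally have s3: "sum G X3 \<le> real M + 2 * real r" by simp
    have "real M * (1 / (real r - 1)) \<le> 2 * real r"
    proof -
      have "real r * real r \<le> 2 * real r * (real r - 1)" using r by (simp add: field_simps)
      then show ?thesis using r by (simp add: M_def power2_eq_square divide_le_eq)
    qed
    then show ?thesis using split s1 s2 s3 by (simp add: M_def)
  qed
  have "G k \<ge> 0" for k by (simp add: G_def)
  then show ?thesis using maj tot unfolding M_def by blast
qed

text \<open>With at most N - 1 points in every cell, adding up \<open>dense\<close> over the (r^2)^d
  shifts of a box, exchanging sums and factoring over the coordinates gives N * (r^2)^d <= (N - 1) *
  (r^2 + 6 * r)^d. This fails for large r.\<close>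

lemma floor_cell_has_many_points:
  fixes \<Lambda> :: "(real^'n) set" and q :: "real \<Rightarrow> real" and N :: nat
  assumes q0: "\<And>t. q t \<ge> 0" and q2: "\<And>t. q t \<le> 1 / t\<^sup>2 \<or> t = 0"
    and q1: "\<And>M x. (\<Sum>n<M. q (x - real n)) \<le> 1" and N: "N > 0"
    and dense: "\<And>\<xi> \<delta>. \<delta> > 0 \<Longrightarrow> \<exists>F\<subseteq>\<Lambda>. finite F \<and> real N - \<delta> \<le> (\<Sum>l\<in>F. \<Prod>i\<in>UNIV. q (l $ i - \<xi> $ i))"
  shows "\<exists>k :: int^'n. \<exists>L\<subseteq>\<Lambda>. finite L \<and> card L = N \<and> (\<forall>l\<in>L. (\<chi> i. \<lfloor>l $ i\<rfloor>) = k)"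
proof (rule ccontr)
  assume no: "\<not> ?thesis"
  define fl where "fl l = (\<chi> i. \<lfloor>l $ i\<rfloor>)" for l :: "real^'n"
  have cell: "card {l\<in>F. fl l = k} \<le> N - 1" if F: "F \<subseteq> \<Lambda>" "finite F" for F k
  proof (rule ccontr)
    assume "\<not> ?thesis"
    then have "N \<le> card {l\<in>F. fl l = k}" using N by simp
    then obtain L where "L \<subseteq> {l\<in>F. fl l = k}" "card L = N" "finite L"
      by (rule obtain_subset_with_card_n)
    moreover from this have "L \<subseteq> \<Lambda>" "\<forall>l\<in>L. (\<chi> i. \<lfloor>l $ i\<rfloor>) = k" using F by (auto simp: fl_def)
    ultimately show False using no by metis
  qed
  define d where "d = CARD('n)"
  have ineq: "real N * ((real r)\<^sup>2)^d \<le> real (N - 1) * ((real r)\<^sup>2 + 6 * real r)^d" if r: "r \<ge> 2" for r :: nat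
  proof -
    define M where "M = r\<^sup>2"
    obtain G :: "int \<Rightarrow> real" where G0: "\<And>k. G k \<ge> 0"
      and Gm: "\<And>x. (\<Sum>n<M. q (x - real n)) \<le> G \<lfloor>x\<rfloor>"
      and Gs: "\<And>X. finite X \<Longrightarrow> sum G X \<le> (real r)\<^sup>2 + 6 * real r"
      using lattice_sum_majorant[OF r q0 q2 q1] unfolding M_def by blast
    define P where "P = PiE (UNIV :: 'n set) (\<lambda>_. {..<M})"
    have finP: "finite P" by (simp add: P_def finite_PiE)
    have cP: "card P = M ^ d" by (simp add: P_def card_PiE d_def)
    have "real N * real (M ^ d) \<le> real (N - 1) * ((real r)\<^sup>2 + 6 * real r)^d + \<eta>" if \<eta>: "\<eta> > 0" for \<eta> :: real
    proof -
      have Mp: "real (M ^ d) > 0" using r by (simp add: M_def)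
      define \<delta> where "\<delta> = \<eta> / real (M ^ d)"
      have "\<delta> > 0" using \<eta> Mp by (simp add: \<delta>_def)
      define v where "v g = (\<chi> i. real (g i))" for g :: "'n \<Rightarrow> nat"
      have "\<forall>g. \<exists>F. F \<subseteq> \<Lambda> \<and> finite F \<and> real N - \<delta> \<le> (\<Sum>l\<in>F. \<Prod>i\<in>UNIV. q (l $ i - v g $ i))"
        using dense[OF \<open>\<delta> > 0\<close>] by blast
      from choice[OF this] obtain F where F0:
        "\<forall>g. F g \<subseteq> \<Lambda> \<and> finite (F g) \<and> real N - \<delta> \<le> (\<Sum>l\<in>F g. \<Prod>i\<in>UNIV. q (l $ i - v g $ i))" ..
      have F: "F g \<subseteq> \<Lambda>" "finite (F g)" "real N - \<delta> \<le> (\<Sum>l\<in>F g. \<Prod>i\<in>UNIV. q (l $ i - v g $ i))" for g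
        using spec[OF F0, of g] by simp_all
      \<comment> \<open>One finite set that serves all shifts keeps the exchange of sums
        finite.\<close>
      define U where "U = (\<Union>g\<in>P. F g)"
      have U: "U \<subseteq> \<Lambda>" "finite U" using F finP by (auto simp: U_def)
      have "real (M ^ d) * (real N - \<delta>) = (\<Sum>g\<in>P. real N - \<delta>)" by (simp add: cP)
      also have "\<dots> \<le> (\<Sum>g\<in>P. \<Sum>l\<in>U. \<Prod>i\<in>UNIV. q (l $ i - real (g i)))"
      proof (rule sum_mono)
        fix g assume g: "g \<in> P"
        have "real N - \<delta> \<le> (\<Sum>l\<in>F g. \<Prod>i\<in>UNIV. q (l $ i - real (g i)))" using F(3)[of g] by (simp add: v_def)
        also have "\<dots> \<le> (\<Sum>l\<in>U. \<Prod>i\<in>UNIV. q (l $ i - real (g i)))"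
          using U g by (intro sum_mono2) (auto simp: U_def q0 prod_nonneg)
        finally show "real N - \<delta> \<le> (\<Sum>l\<in>U. \<Prod>i\<in>UNIV. q (l $ i - real (g i)))" .
      qed
      also have "\<dots> = (\<Sum>l\<in>U. \<Sum>g\<in>P. \<Prod>i\<in>UNIV. q (l $ i - real (g i)))" by (rule sum.swap)
      also have "\<dots> = (\<Sum>l\<in>U. \<Prod>i\<in>UNIV. \<Sum>n<M. q (l $ i - real n))"
        unfolding P_def by (intro sum.cong refl prod_sum_PiE[symmetric]) auto
      also have "\<dots> \<le> (\<Sum>l\<in>U. \<Prod>i\<in>UNIV. G (fl l $ i))"
        by (intro sum_mono prod_mono) (auto simp: fl_def q0 sum_nonneg Gm)
      also have "\<dots> = (\<Sum>k\<in>fl ` U. \<Sum>l\<in>{l\<in>U. fl l = k}. \<Prod>i\<in>UNIV. G (fl l $ i))"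
        by (rule sum.image_gen[OF U(2)])
      also have "\<dots> = (\<Sum>k\<in>fl ` U. real (card {l\<in>U. fl l = k}) * (\<Prod>i\<in>UNIV. G (k $ i)))"
        by (intro sum.cong refl) simp
      also have "\<dots> \<le> (\<Sum>k\<in>fl ` U. real (N - 1) * (\<Prod>i\<in>UNIV. G (k $ i)))"
        using cell[OF U] by (intro sum_mono mult_right_mono prod_nonneg) (auto simp: G0 simp del: of_nat_diff)
      also have "\<dots> = real (N - 1) * (\<Sum>k\<in>fl ` U. \<Prod>i\<in>UNIV. G (k $ i))" by (simp add: sum_distrib_left)
      also have "\<dots> \<le> real (N - 1) * ((real r)\<^sup>2 + 6 * real r)^d"
      proof (rule mult_left_mono)
        \<comment> \<open>All coordinates of occupied cells. Enlarging the sum to the full grid over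
          Y makes it a product of one-dimensional sums.\<close>
        define Y where "Y = (\<Union>k\<in>fl ` U. range (($) k))"
        have finY: "finite Y" using U by (simp add: Y_def)
        have "(\<Sum>k\<in>fl ` U. \<Prod>i\<in>UNIV. G (k $ i)) = (\<Sum>g\<in>($) ` (fl ` U). \<Prod>i\<in>UNIV. G (g i))"
          by (subst sum.reindex) (auto simp: inj_on_def vec_eq_iff fun_eq_iff)
        also have "\<dots> \<le> (\<Sum>g\<in>PiE (UNIV :: 'n set) (\<lambda>_. Y). \<Prod>i\<in>UNIV. G (g i))"
          using finY by (intro sum_mono2 finite_PiE prod_nonneg) (auto simp: Y_def G0)
        also have "\<dots> = (\<Prod>i\<in>(UNIV::'n set). sum G Y)"
          using finY by (intro prod_sum_PiE[symmetric]) auto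
        also have "\<dots> = sum G Y ^ d" by (simp add: d_def)
        also have "\<dots> \<le> ((real r)\<^sup>2 + 6 * real r)^d"
          using Gs[OF finY] by (intro power_mono sum_nonneg G0)
        finally show "(\<Sum>k\<in>fl ` U. \<Prod>i\<in>UNIV. G (k $ i)) \<le> ((real r)\<^sup>2 + 6 * real r)^d" .
      qed simp
      finally have "real (M ^ d) * (real N - \<delta>) \<le> real (N - 1) * ((real r)\<^sup>2 + 6 * real r)^d" .
      moreover have "real (M ^ d) * \<delta> = \<eta>" using Mp by (simp add: \<delta>_def)
      moreover have "real N * real (M ^ d) = real (M ^ d) * (real N - \<delta>) + real (M ^ d) * \<delta>"
        by (simp only: right_diff_distrib mult.commute[of "real N"] diff_add_cancel)
      ultimately show ?thesis by simp
    qed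
    then have "real N * real (M ^ d) \<le> real (N - 1) * ((real r)\<^sup>2 + 6 * real r)^d" by (rule field_le_epsilon)
    then show ?thesis by (simp add: M_def)
  qed
  have "real N \<le> real (N - 1) * (1 + 6 / real r)^d" if r: "r \<ge> 2" for r :: nat
  proof -
    have "(real r)\<^sup>2 + 6 * real r = (real r)\<^sup>2 * (1 + 6 / real r)" using r by (simp add: field_simps power2_eq_square)
    then have "real N * ((real r)\<^sup>2)^d \<le> real (N - 1) * (1 + 6 / real r)^d * ((real r)\<^sup>2)^d"
      using ineq[OF r] by (simp only: power_mult_distrib) (simp add: mult_ac)
    moreover have "((real r)\<^sup>2)^d > 0" using r by simp
    ultimately show ?thesis by (simp only: mult_le_cancel_right_pos)
  qed
  moreover have "(\<lambda>r::nat. real (N - 1) * (1 + 6 / real r)^d) \<longlonglongrightarrow> real (N - 1) * (1 + 0)^d"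
    by (intro tendsto_intros lim_const_over_n)
  ultimately have "real N \<le> real (N - 1) * (1 + 0)^d"
    by (intro LIMSEQ_le_const) auto
  then show False using N by simp
qed

section \<open>Fourier transform of a union of unit cubes\<close>

text \<open>The Fourier transform of the indicator of [0,1) at -t; the interval is half-open to
  match the cells.\<close>

definition unit_fourier :: "real \<Rightarrow> complex" where
  "unit_fourier t = (LINT s|lborel. indicator {0..<1} s *\<^sub>R cis (2 * pi * t * s))"

text \<open>Prepares for the fundamental theorem of calculus, which is applied on a closed
  interval.\<close>

lemma unit_fourier_eq_Icc:
  "unit_fourier t = (LINT s|lborel. indicator {0..1} s *\<^sub>R cis (2 * pi * t * s))"
proof -
  have [measurable]: "(\<lambda>s. cis (2 * pi * t * s)) \<in> borel_measurable borel"
    by (intro borel_measurable_continuous_onI continuous_intros)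
  show ?thesis unfolding unit_fourier_def
  proof (rule integral_cong_AE)
    show "AE s in lborel. indicator {0..<1} s *\<^sub>R cis (2 * pi * t * s) = indicator {0..1} s *\<^sub>R cis (2 * pi * t * s)"
      using AE_lborel_singleton[of "1::real"] by eventually_elim (auto simp: indicator_def)
  qed measurable
qed

lemma unit_fourier_0: "unit_fourier 0 = 1"
proof -
  have "(LINT s|lborel. indicator {0..1::real} s *\<^sub>R (1::complex)) = (LINT s|lborel. indicator {0..1::real} s) *\<^sub>R 1"
    by (rule integral_scaleR_left) simp
  then show ?thesis by (simp add: unit_fourier_eq_Icc)
qed

lemma unit_fourier_nonzero_arg:
  assumes "t \<noteq> 0"
  shows "unit_fourier t = (cis (2 * pi * t) - 1) / (\<i> * of_real (2 * pi * t))"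
proof -
  let ?F = "\<lambda>s. cis (2 * pi * t * s) / (\<i> * of_real (2 * pi * t))"
  have "(LINT s|lborel. indicator {0..1} s *\<^sub>R cis (2 * pi * t * s)) = ?F 1 - ?F 0"
  proof (rule integral_FTC_Icc)
    fix s :: real
    have e: "cis (2 * pi * t * s) = exp (\<i> * of_real (2 * pi * t) * of_real s)" for s
      by (simp add: cis_conv_exp mult_ac)
    have "((\<lambda>z. exp (\<i> * of_real (2 * pi * t) * z) / (\<i> * of_real (2 * pi * t)))
        has_field_derivative exp (\<i> * of_real (2 * pi * t) * of_real s)) (at (of_real s))"
      using assms by (auto intro!: derivative_eq_intros)
    from has_vector_derivative_real_field[OF this]
    show "(?F has_vector_derivative cis (2 * pi * t * s)) (at s within {0..1})" unfolding e .
  qed (auto intro!: continuous_intros)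
  then show ?thesis by (simp add: unit_fourier_eq_Icc diff_divide_distrib)
qed

lemma unit_fourier_nonzero:
  assumes "\<bar>t\<bar> < 1"
  shows "unit_fourier t \<noteq> 0"
proof (cases "t = 0")
  case False
  have "t \<notin> \<int>"
  proof
    assume "t \<in> \<int>"
    then obtain n :: int where "t = of_int n" by (auto simp: Ints_def)
    then show False using assms False by simp
  qed
  then have "cis (2 * pi * t) \<noteq> 1" using cis_2pi_eq_iff[of t 0] by simp
  then show ?thesis using False by (simp add: unit_fourier_nonzero_arg)
qed (simp add: unit_fourier_0)

lemma unit_fourier_nonzero_int:
  assumes "t \<in> \<int>" "t \<noteq> 0"
  shows "unit_fourier t = 0"
  using assms by (simp add: unit_fourier_nonzero_arg)

text \<open>The numerator has norm at most 2, and pi >= 2 is enough. The disjunct t = 0 is there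
  because 1 / 0 = 0, while the transform is 1 at 0.\<close>

lemma norm_unit_fourier_sq_le: "(norm (unit_fourier t))\<^sup>2 \<le> 1 / t\<^sup>2 \<or> t = 0"
proof (cases "t = 0")
  case False
  have "norm (cis (2 * pi * t) - 1) \<le> 2"
    using norm_triangle_ineq4[of "cis (2 * pi * t)" 1] by simp
  then have "norm (cis (2 * pi * t) - 1) / (2 * pi * \<bar>t\<bar>) \<le> 2 / (2 * pi * \<bar>t\<bar>)"
    by (intro divide_right_mono) auto
  then have "norm (unit_fourier t) \<le> 2 / (2 * pi * \<bar>t\<bar>)"
    using False by (simp add: unit_fourier_nonzero_arg norm_divide norm_mult)
  also have "\<dots> \<le> 1 / \<bar>t\<bar>"
    using False pi_ge_two by (simp add: field_simps)
  finally have "(norm (unit_fourier t))\<^sup>2 \<le> (1 / \<bar>t\<bar>)\<^sup>2" by (intro power_mono) auto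
  then show ?thesis by (simp add: power_divide)
qed simp

text \<open>Bessel's inequality on [0,1) for the exponential of frequency x against the orthonormal
  exponentials of integer frequency; the coefficients are the values of \<open>unit_fourier\<close>
  at x - n.\<close>

lemma sum_norm_unit_fourier_sq_le: "(\<Sum>n<M. (norm (unit_fourier (x - real n)))\<^sup>2) \<le> 1"
proof -
  define L where "L = restrict_space lborel {0..<1::real}"
  have cm: "(\<lambda>s. cis (2 * pi * t * s)) \<in> borel_measurable borel" for t
    by (intro borel_measurable_continuous_onI continuous_intros)
  have cL: "(\<lambda>s. cis (2 * pi * t * s)) \<in> borel_measurable L" for t
    unfolding L_def by (rule measurable_restrict_space1) (simp add: cm)
  have mL: "measure L (space L) = 1"
    by (simp add: L_def space_restrict_space measure_restrict_space)
  have fm: "finite_measure L"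
    by (rule finite_measureI) (simp add: L_def space_restrict_space emeasure_restrict_space)
  have int: "(LINT s|L. cis (2 * pi * t * s) * cnj (cis (2 * pi * u * s))) = unit_fourier (t - u)" for t u
    unfolding L_def unit_fourier_def
    by (subst integral_restrict_space) (simp_all add: cis_cnj cis_mult left_diff_distrib right_diff_distrib)
  have "(\<Sum>n<M. (norm (LINT s|L. cis (2 * pi * x * s) * cnj (cis (2 * pi * real n * s))))\<^sup>2)
      \<le> measure L (space L) * (LINT s|L. (norm (cis (2 * pi * x * s)))\<^sup>2)"
  proof (rule bessel_inequality[where B = 1])
    show "(LINT s|L. cis (2 * pi * real i * s) * cnj (cis (2 * pi * real j * s))) = 0" if "i \<noteq> j" for i j
      unfolding int using that by (intro unit_fourier_nonzero_int) auto
  qed (auto simp: fm cL mL)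
  then show ?thesis by (simp add: int mL)
qed

section \<open>Integrals of exponentials over cells\<close>

lemma cis_sum: "finite S \<Longrightarrow> cis (sum f S) = (\<Prod>i\<in>S. cis (f i))"
  by (induction S rule: finite_induct) (auto simp: cis_mult[symmetric])

text \<open>Lebesgue measure on vectors is the image of a product measure indexed by
  \<open>Basis\<close>, so the factors are first transported along the bijection from i to
  \<open>axis i 1\<close>; the rest is Fubini.\<close>

lemma integral_lborel_prod_vec:
  fixes f :: "'n::finite \<Rightarrow> real \<Rightarrow> complex"
  assumes int: "\<And>i. integrable lborel (f i)"
  shows "(LINT x|lborel. (\<Prod>i\<in>UNIV. f i (x $ i))) = (\<Prod>i\<in>UNIV. integral\<^sup>L lborel (f i))"
proof -
  interpret product_sigma_finite "\<lambda>_::real^'n. lborel :: real measure" ..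
  have bij: "bij_betw (\<lambda>i. axis i 1 :: real^'n) UNIV Basis"
    by (auto simp: bij_betw_def inj_on_def axis_eq_axis Basis_vec_def)
  define g where "g b = f (the_inv_into UNIV (\<lambda>i. axis i 1 :: real^'n) b)" for b
  have g: "g (axis i 1) = f i" for i
    unfolding g_def using bij by (subst the_inv_into_f_f) (auto simp: bij_betw_def)
  have [measurable]: "f i \<in> borel_measurable borel" for i
    using borel_measurable_integrable[OF int[of i]] by simp
  have gm: "integrable lborel (g b)" for b by (simp add: g_def int)
  have [measurable]: "g b \<in> borel_measurable borel" for b
    using borel_measurable_integrable[OF gm[of b]] by simp
  have "(LINT x|lborel. (\<Prod>i\<in>UNIV. f i (x $ i))) = (LINT x|lborel. (\<Prod>b\<in>Basis. g b (x \<bullet> b)))"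
    by (simp add: prod.reindex_bij_betw[OF bij, symmetric] g inner_axis)
  also have "\<dots> = (LINT y|(\<Pi>\<^sub>M b\<in>(Basis :: (real^'n) set). lborel). (\<Prod>b\<in>Basis. g b ((\<Sum>b\<in>Basis. y b *\<^sub>R b) \<bullet> b)))"
    by (subst lborel_eq, subst integral_distr) measurable
  also have "\<dots> = (LINT y|(\<Pi>\<^sub>M b\<in>(Basis :: (real^'n) set). lborel). (\<Prod>b\<in>Basis. g b (y b)))"
    by (intro Bochner_Integration.integral_cong refl prod.cong) simp
  also have "\<dots> = (\<Prod>b\<in>Basis. integral\<^sup>L lborel (g b))"
    by (rule product_integral_prod) (auto simp: gm)
  also have "\<dots> = (\<Prod>i\<in>UNIV. integral\<^sup>L lborel (f i))"
    by (simp add: prod.reindex_bij_betw[OF bij, symmetric] g)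
  finally show ?thesis .
qed

lemma expo_eq_cis: "expo l x = cis (2 * pi * (l \<bullet> x))"
  by (simp add: expo_def cis_conv_exp mult_ac)

lemma integrable_cell_fourier_1d: "integrable lborel (\<lambda>s. indicator {a..<b} s *\<^sub>R cis (c * s))"
proof (rule Bochner_Integration.integrable_bound[where f = "indicator {a..<b} :: real \<Rightarrow> real"])
  show "integrable lborel (indicator {a..<b} :: real \<Rightarrow> real)"
    by (cases "a \<le> b") simp_all
  have [measurable]: "(\<lambda>s. cis (c * s)) \<in> borel_measurable borel"
    by (intro borel_measurable_continuous_onI continuous_intros)
  show "(\<lambda>s. indicator {a..<b} s *\<^sub>R cis (c * s)) \<in> borel_measurable lborel" by measurable
qed (auto simp: indicator_def)

lemma integral_cell_fourier_1d:
  "(LINT s|lborel. indicator {a..<a + 1} s *\<^sub>R cis (2 * pi * t * s)) = cis (2 * pi * t * a) * unit_fourier t"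
proof -
  have "(LINT s|lborel. indicator {a..<a + 1} s *\<^sub>R cis (2 * pi * t * s)) =
      (LINT s|lborel. indicator {a..<a + 1} (a + s) *\<^sub>R cis (2 * pi * t * (a + s)))"
    using lborel_integral_real_affine[of 1 "\<lambda>s. indicator {a..<a + 1} s *\<^sub>R cis (2 * pi * t * s)" a] by simp
  also have "\<dots> = (LINT s|lborel. cis (2 * pi * t * a) * (indicator {0..<1} s *\<^sub>R cis (2 * pi * t * s)))"
    by (intro Bochner_Integration.integral_cong refl) (auto simp: indicator_def cis_mult distrib_left)
  also have "\<dots> = cis (2 * pi * t * a) * unit_fourier t"
    unfolding unit_fourier_def by (rule integral_mult_right_zero)
  finally show ?thesis .
qed

lemma integral_cell_expo:
  fixes a :: "int^'n"
  shows "(LINT x|lborel. indicator (cube_union {a}) x *\<^sub>R expo \<xi> x) =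
    cis (2 * pi * (\<xi> \<bullet> real_vec a)) * (\<Prod>i\<in>UNIV. unit_fourier (\<xi> $ i))"
proof -
  define f where "f i s = indicator {real_of_int (a $ i)..<real_of_int (a $ i) + 1} s *\<^sub>R cis (2 * pi * \<xi> $ i * s)" for i s
  have split: "cis (2 * pi * (\<xi> \<bullet> x)) = (\<Prod>i\<in>UNIV. cis (2 * pi * \<xi> $ i * x $ i))" for x
    by (simp add: inner_vec_def sum_distrib_left cis_sum mult.assoc)
  have "indicator (cube_union {a}) x *\<^sub>R expo \<xi> x = (\<Prod>i\<in>UNIV. f i (x $ i))" for x
  proof (cases "x \<in> cube_union {a}")
    case True
    then show ?thesis by (simp add: f_def cube_union_def expo_eq_cis split)
  next
    case False
    then obtain i where "\<not> (of_int (a $ i) \<le> x $ i \<and> x $ i < of_int (a $ i) + 1)"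
      by (auto simp: cube_union_def)
    then have "f i (x $ i) = 0" by (auto simp: f_def)
    then have "(\<Prod>i\<in>UNIV. f i (x $ i)) = 0" by (intro prod_zero) auto
    then show ?thesis using False by simp
  qed
  then have "(LINT x|lborel. indicator (cube_union {a}) x *\<^sub>R expo \<xi> x) = (LINT x|lborel. (\<Prod>i\<in>UNIV. f i (x $ i)))"
    by simp
  also have "\<dots> = (\<Prod>i\<in>UNIV. integral\<^sup>L lborel (f i))"
    unfolding f_def by (intro integral_lborel_prod_vec integrable_cell_fourier_1d)
  also have "\<dots> = (\<Prod>i\<in>UNIV. cis (2 * pi * \<xi> $ i * real_vec a $ i) * unit_fourier (\<xi> $ i))"
    by (simp add: f_def[abs_def] integral_cell_fourier_1d real_vec_def)
  also have "\<dots> = cis (2 * pi * (\<xi> \<bullet> real_vec a)) * (\<Prod>i\<in>UNIV. unit_fourier (\<xi> $ i))"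
    by (simp only: split prod.distrib)
  finally show ?thesis .
qed

lemma unit_fourier_minus: "norm (unit_fourier (- t)) = norm (unit_fourier t)"
proof (cases "t = 0")
  case False
  have "norm (cis (- (2 * pi * t)) - 1) = norm (cnj (cis (2 * pi * t) - 1))" by (simp add: cis_cnj)
  then show ?thesis using False by (simp add: unit_fourier_nonzero_arg norm_divide norm_mult del: complex_cnj_diff)
qed simp

section \<open>Measurability and volume of unions of cells\<close>

lemma borel_cell: "cube_union {a :: int^'n} \<in> sets borel"
proof -
  have "cube_union {a} = (\<Inter>i\<in>UNIV. {x. of_int (a $ i) \<le> x $ i} \<inter> {x. x $ i < of_int (a $ i) + 1})"
    by (auto simp: cube_union_def)
  also have "\<dots> \<in> sets borel"
    by (intro sets.finite_INT sets.Int borel_closed borel_open closed_Collect_le open_Collect_less continuous_intros) auto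
  finally show ?thesis .
qed

lemma cube_union_UN: "cube_union A = (\<Union>a\<in>A. cube_union {a})"
  by (auto simp: cube_union_def)

lemma borel_cube_union: "finite A \<Longrightarrow> cube_union A \<in> sets borel"
  by (subst cube_union_UN) (intro sets.finite_UN borel_cell)

lemma indicator_cube_union:
  assumes "finite A"
  shows "(indicator (cube_union A) x :: real) = (\<Sum>a\<in>A. indicator (cube_union {a}) x)"
proof -
  have "(\<Sum>a\<in>A. indicator (cube_union {a}) x :: real) = (\<Sum>a\<in>A. if a = (\<chi> i. \<lfloor>x $ i\<rfloor>) then 1 else 0)"
    by (intro sum.cong refl) (auto simp: indicator_def cube_union_iff_floor)
  then show ?thesis using assms by (simp add: indicator_def cube_union_iff_floor)
qed

lemma expo_0: "expo 0 x = 1"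
  by (simp add: expo_def)

lemma norm_expo: "norm (expo l x) = 1"
  by (simp add: expo_eq_cis)

lemma expo_mult_cnj: "expo l x * cnj (expo m x) = expo (l - m) x"
  by (simp add: expo_eq_cis cis_cnj cis_mult inner_diff_left right_diff_distrib)

lemma borel_measurable_expo [measurable]: "expo l \<in> borel_measurable borel"
  unfolding expo_def by (intro borel_measurable_continuous_onI continuous_intros)

text \<open>Read off from the exponential integral at frequency 0.\<close>

lemma measure_cell: "measure lborel (cube_union {a :: int^'n}) = 1"
proof -
  have "complex_of_real (measure lborel (cube_union {a})) = (LINT x|lborel. complex_of_real (indicator (cube_union {a}) x))"
    using borel_cell[of a] by (subst integral_complex_of_real) simp
  also have "\<dots> = (LINT x|lborel. indicator (cube_union {a}) x *\<^sub>R expo 0 x)"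
    by (simp add: expo_0 scaleR_conv_of_real)
  also have "\<dots> = of_real 1" by (subst integral_cell_expo) (simp add: unit_fourier_0)
  finally show ?thesis by (simp only: of_real_eq_iff)
qed

lemma emeasure_cell: "emeasure lborel (cube_union {a :: int^'n}) = 1"
proof -
  \<comment> \<open>An infinite measure would be turned into 0 by \<open>measure\<close>.\<close>
  have "emeasure lborel (cube_union {a}) \<noteq> \<infinity>"
    using measure_cell[of a] by (auto simp: measure_def)
  then show ?thesis using measure_cell[of a] by (simp add: emeasure_eq_ennreal_measure)
qed

lemma integrable_cell_expo: "integrable lborel (\<lambda>x. indicator (cube_union {a :: int^'n}) x *\<^sub>R expo \<xi> x)"
proof (rule Bochner_Integration.integrable_bound[where f = "indicator (cube_union {a}) :: _ \<Rightarrow> real"])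
  show "integrable lborel (indicator (cube_union {a}) :: _ \<Rightarrow> real)"
    using borel_cell[of a] by (simp add: emeasure_cell)
  show "(\<lambda>x. indicator (cube_union {a}) x *\<^sub>R expo \<xi> x) \<in> borel_measurable lborel"
    using borel_cell[of a] by measurable
qed (simp add: norm_expo)

lemma integral_cube_union_expo:
  fixes A :: "(int^'n) set"
  assumes A: "finite A"
  shows "(LINT x|lborel. indicator (cube_union A) x *\<^sub>R expo \<xi> x) =
    (\<Sum>a\<in>A. cis (2 * pi * (\<xi> \<bullet> real_vec a))) * (\<Prod>i\<in>UNIV. unit_fourier (\<xi> $ i))"
proof -
  have "(LINT x|lborel. indicator (cube_union A) x *\<^sub>R expo \<xi> x) =
      (LINT x|lborel. (\<Sum>a\<in>A. indicator (cube_union {a}) x *\<^sub>R expo \<xi> x))"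
    by (simp add: indicator_cube_union[OF A] scaleR_sum_left)
  also have "\<dots> = (\<Sum>a\<in>A. LINT x|lborel. indicator (cube_union {a}) x *\<^sub>R expo \<xi> x)"
    by (intro Bochner_Integration.integral_sum integrable_cell_expo)
  finally show ?thesis by (simp add: integral_cell_expo sum_distrib_right)
qed

lemma measure_cube_union:
  fixes A :: "(int^'n) set"
  assumes A: "finite A"
  shows "measure lborel (cube_union A) = card A" "emeasure lborel (cube_union A) \<noteq> \<infinity>"
proof -
  have d: "disjoint_family_on (\<lambda>a. cube_union {a}) A"
    by (auto simp: disjoint_family_on_def cube_union_iff_floor)
  have "emeasure lborel (cube_union A) = (\<Sum>a\<in>A. emeasure lborel (cube_union {a}))"
    unfolding cube_union_UN[of A] using A d borel_cell
    by (intro sum_emeasure[symmetric]) auto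
  then have e: "emeasure lborel (cube_union A) = of_nat (card A)" by (simp add: emeasure_cell)
  then show "emeasure lborel (cube_union A) \<noteq> \<infinity>" by simp
  show "measure lborel (cube_union A) = card A" using e by (simp add: measure_def)
qed

section \<open>Parseval for a spectrum, and the conclusion\<close>

lemma spectrum_parseval:
  fixes A :: "(int^'n) set"
  assumes A: "finite A" "A \<noteq> {}" and sp: "spectrum_of (cube_union A) \<Lambda>" and \<delta>: "\<delta> > 0"
  shows "\<exists>F\<subseteq>\<Lambda>. finite F \<and>
    real (card A) - \<delta> \<le> (\<Sum>l\<in>F. \<Prod>i\<in>UNIV. (norm (unit_fourier (l $ i - \<xi> $ i)))\<^sup>2)"
proof -
  define \<Omega> where "\<Omega> = cube_union A"
  \<comment> \<open>\<open>spectrum_of\<close> concerns Lebesgue measurable functions, the Fourier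
    computations Borel ones. M is the completed measure on Omega, and \<open>int\<close> passes to
    \<open>lborel\<close> for Borel integrands.\<close>
  define M where "M = restrict_space lebesgue \<Omega>"
  have \<Omega>: "\<Omega> \<in> sets borel" unfolding \<Omega>_def using A(1) by (rule borel_cube_union)
  then have \<Omega>L: "\<Omega> \<in> sets lebesgue" by auto
  then have \<Omega>': "\<Omega> \<inter> space lebesgue \<in> sets lebesgue" by simp
  obtain a where a: "a \<in> A" using A(2) by blast
  define Q where "Q = cube_union {a}"
  have Q [measurable]: "Q \<in> sets borel" unfolding Q_def by (rule borel_cell)
  have Q\<Omega>: "Q \<subseteq> \<Omega>" using a by (auto simp: Q_def \<Omega>_def cube_union_def)
  define f where "f x = indicator Q x *\<^sub>R expo \<xi> x" for x
  have fb [measurable]: "f \<in> borel_measurable borel" unfolding f_def using Q by measurable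
  have meas: "g \<in> borel_measurable M" if "g \<in> borel_measurable borel" for g :: "real^'n \<Rightarrow> complex"
    unfolding M_def using that by (intro measurable_restrict_space1 measurable_completion) simp
  have int: "integral\<^sup>L M g = (LINT x|lborel. indicator \<Omega> x *\<^sub>R g x)"
    if [measurable]: "g \<in> borel_measurable borel" for g :: "real^'n \<Rightarrow> complex"
  proof -
    have "(\<lambda>x. indicator \<Omega> x *\<^sub>R g x) \<in> lborel \<rightarrow>\<^sub>M borel" using \<Omega> by measurable
    then show ?thesis unfolding M_def integral_restrict_space[OF \<Omega>'] by (rule integral_completion)
  qed
  have sM: "space M = \<Omega>" by (simp add: M_def space_restrict_space)
  have mM: "measure M (space M) = card A"
    unfolding sM using measure_cube_union(1)[OF A(1)] \<Omega> \<Omega>L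
    by (simp add: M_def measure_restrict_space \<Omega>_def[symmetric])
  have fin: "finite_measure M"
    using measure_cube_union(2)[OF A(1)] \<Omega> \<Omega>L
    by (intro finite_measureI) (simp add: sM M_def emeasure_restrict_space \<Omega>_def[symmetric])
  have orth: "(LINT x|M. expo l x * cnj (expo m x)) = 0" if "l \<in> \<Lambda>" "m \<in> \<Lambda>" "l \<noteq> m" for l m
    using sp that unfolding spectrum_of_def \<Omega>_def[symmetric] M_def integral_restrict_space[OF \<Omega>'] set_lebesgue_integral_def
    by blast
  have complete: "AE x in M. h x = 0"
    if h: "h \<in> borel_measurable M" "integrable M (\<lambda>x. (norm (h x))\<^sup>2)"
      "\<And>l. l \<in> \<Lambda> \<Longrightarrow> (LINT x|M. h x * cnj (expo l x)) = 0" for h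
  proof -
    \<comment> \<open>A test function for M is controlled only on Omega; extended by 0 it is
      measurable on the whole space, as \<open>L2_on\<close> demands.\<close>
    define h' where "h' x = indicator \<Omega> x *\<^sub>R h x" for x
    have m: "h' \<in> borel_measurable lebesgue"
      using h(1) unfolding M_def borel_measurable_restrict_space_iff[OF \<Omega>'] h'_def .
    have e: "indicator \<Omega> x *\<^sub>R (norm (h' x))\<^sup>2 = indicator \<Omega> x *\<^sub>R (norm (h x))\<^sup>2" for x
      by (simp add: h'_def indicator_def)
    have "set_integrable lebesgue \<Omega> (\<lambda>x. (norm (h' x))\<^sup>2)"
      using h(2) unfolding M_def integrable_restrict_space[OF \<Omega>'] set_integrable_def e .
    then have "L2_on \<Omega> h'" using m by (simp add: L2_on_def)
    moreover have "(LINT x:\<Omega>|lebesgue. h' x * cnj (expo l x)) = 0" if "l \<in> \<Lambda>" for l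
    proof -
      have e: "indicator \<Omega> x *\<^sub>R (h' x * cnj (expo l x)) = indicator \<Omega> x *\<^sub>R (h x * cnj (expo l x))" for x
        by (simp add: h'_def indicator_def)
      show ?thesis
        using h(3)[OF that] unfolding M_def integral_restrict_space[OF \<Omega>'] set_lebesgue_integral_def e .
    qed
    ultimately have "AE x in lebesgue. x \<in> \<Omega> \<longrightarrow> h' x = 0"
      using sp unfolding spectrum_of_def \<Omega>_def[symmetric] by blast
    then show ?thesis unfolding M_def AE_restrict_space_iff[OF \<Omega>']
      by eventually_elim (auto simp: h'_def)
  qed
  have "\<exists>F\<subseteq>\<Lambda>. finite F \<and> measure M (space M) * (LINT x|M. (norm (f x))\<^sup>2) - \<delta>
      \<le> (\<Sum>l\<in>F. (norm (LINT x|M. f x * cnj (expo l x)))\<^sup>2)"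
  proof (rule parseval_if_complete[OF fin _ meas[OF borel_measurable_expo] norm_expo orth complete meas[OF fb] _ \<delta>])
    show "measure M (space M) > 0" using A by (simp add: mM card_gt_0_iff)
    show "norm (f x) \<le> 1" for x by (simp add: f_def norm_expo indicator_def)
  qed
  moreover have "(LINT x|M. (norm (f x))\<^sup>2) = 1"
  proof -
    have "(norm (f x))\<^sup>2 = indicator Q x" for x by (simp add: f_def norm_expo indicator_def)
    then have "complex_of_real (LINT x|M. (norm (f x))\<^sup>2) = (LINT x|M. complex_of_real (indicator Q x))"
      by (simp only: integral_complex_of_real)
    also have "\<dots> = (LINT x|lborel. indicator \<Omega> x *\<^sub>R complex_of_real (indicator Q x))"
      by (rule int) measurable
    also have "\<dots> = (LINT x|lborel. complex_of_real (indicator Q x))"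
      using Q\<Omega> by (intro Bochner_Integration.integral_cong refl) (auto simp: indicator_def)
    also have "\<dots> = of_real (measure lborel Q)" using Q by (subst integral_complex_of_real) simp
    finally show ?thesis unfolding of_real_eq_iff by (simp add: Q_def measure_cell)
  qed
  moreover have "(norm (LINT x|M. f x * cnj (expo l x)))\<^sup>2 = (\<Prod>i\<in>UNIV. (norm (unit_fourier (l $ i - \<xi> $ i)))\<^sup>2)" for l
  proof -
    have "(LINT x|M. f x * cnj (expo l x)) = (LINT x|lborel. indicator \<Omega> x *\<^sub>R (f x * cnj (expo l x)))"
      by (intro int borel_measurable_times borel_measurable_cnj fb borel_measurable_expo)
    also have "\<dots> = (LINT x|lborel. indicator Q x *\<^sub>R expo (\<xi> - l) x)"
      using Q\<Omega> by (intro Bochner_Integration.integral_cong refl)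
        (auto simp: indicator_def f_def expo_mult_cnj)
    also have "norm \<dots> = (\<Prod>i\<in>UNIV. norm (unit_fourier ((\<xi> - l) $ i)))"
      unfolding Q_def integral_cell_expo by (simp add: norm_mult prod_norm)
    also have "\<dots> = (\<Prod>i\<in>UNIV. norm (unit_fourier (l $ i - \<xi> $ i)))"
    proof (intro prod.cong refl)
      fix i
      show "norm (unit_fourier ((\<xi> - l) $ i)) = norm (unit_fourier (l $ i - \<xi> $ i))"
        using unit_fourier_minus[of "l $ i - \<xi> $ i"] by simp
    qed
    finally show ?thesis by (simp add: prod_power_distrib)
  qed
  ultimately show ?thesis by (simp add: mM)
qed

text \<open>The empty set has to be excluded: it is vacuously spectral, but its translates cover
  nothing. Finiteness has to be explicit because \<open>card\<close> is 0 on infinite sets.\<close>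

theorem theorem2p4:
  fixes A :: "(int^'n) set"
  assumes "A \<noteq> {}" and "finite A" and "card A \<le> 5"
    and "spectral (cube_union A)"
  shows "tiles (cube_union A)"
proof -
  obtain \<Lambda> where sp: "spectrum_of (cube_union A) \<Lambda>" using assms(4) by (auto simp: spectral_def)
  have "\<exists>k :: int^'n. \<exists>L\<subseteq>\<Lambda>. finite L \<and> card L = card A \<and> (\<forall>l\<in>L. (\<chi> i. \<lfloor>l $ i\<rfloor>) = k)"
  proof (rule floor_cell_has_many_points[where q = "\<lambda>t. (norm (unit_fourier t))\<^sup>2"])
    show "card A > 0" using assms by (simp add: card_gt_0_iff)
  qed (use spectrum_parseval[OF assms(2,1) sp] norm_unit_fourier_sq_le sum_norm_unit_fourier_sq_le in auto)
  then obtain k :: "int^'n" and L where L: "L \<subseteq> \<Lambda>" "finite L" "card L = card A"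
    and k: "\<And>l. l \<in> L \<Longrightarrow> (\<chi> i. \<lfloor>l $ i\<rfloor>) = k" by blast
  show ?thesis
  proof (rule tiles_if_lattice_spectrum[OF assms(2,1,3) L(2,3)])
    fix l m assume lm: "l \<in> L" "m \<in> L" "l \<noteq> m"
    have \<Omega>: "cube_union A \<in> sets borel" using assms(2) by (rule borel_cube_union)
    have "(LINT x:cube_union A|lebesgue. expo l x * cnj (expo m x)) = 0"
      using sp lm L(1) unfolding spectrum_of_def by blast
    then have "(LINT x|lebesgue. indicator (cube_union A) x *\<^sub>R expo (l - m) x) = 0"
      by (simp add: set_lebesgue_integral_def expo_mult_cnj)
    moreover have "(\<lambda>x. indicator (cube_union A) x *\<^sub>R expo (l - m) x) \<in> lborel \<rightarrow>\<^sub>M borel"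
      using \<Omega> by measurable
    ultimately have "(LINT x|lborel. indicator (cube_union A) x *\<^sub>R expo (l - m) x) = 0"
      by (simp add: integral_completion)
    then have "(\<Sum>a\<in>A. cis (2 * pi * ((l - m) \<bullet> real_vec a))) * (\<Prod>i\<in>UNIV. unit_fourier ((l - m) $ i)) = 0"
      by (simp only: integral_cube_union_expo[OF assms(2)])
    moreover have "unit_fourier ((l - m) $ i) \<noteq> 0" for i
    proof (rule unit_fourier_nonzero)
      have "\<lfloor>l $ i\<rfloor> = \<lfloor>m $ i\<rfloor>" using k[OF lm(1)] k[OF lm(2)] by (metis vec_lambda_beta)
      then show "\<bar>(l - m) $ i\<bar> < 1" unfolding vector_minus_component by linarith
    qed
    ultimately show "(\<Sum>a\<in>A. cis (2 * pi * ((l - m) \<bullet> real_vec a))) = 0" by simp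
  qed
qed

unused_thms

end
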